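(* Let $R$ be a semisimple ring and let $R= M_{n_1}(D_1)\times \dots \times M_{n_l}(D_l)$ be its Wedderburn–Artin decomposition, where $D_1,\dots,D_l$ are division rings. Then $$\operatorname{diam}(R)=\max\{n_i-1\mid 1\le i\le l\}.$$
   Context: All rings are unital. For elements $a,b$ of a ring $R$, write $a\sim_1 b$ if there exist $c,d\in R$ with $a=cd$ and $b=dc$; inductively, $a\sim_{n+1}b$ if there exists $c\in R$ with $a\sim_1 c$ and $c\sim_n b$; $a\sim_0 b$ means $a=b$. Write $a\sim b$ if $a\sim_n b$ for some $n$. The commutative closure of $a$ is $C(a)=\overline{\{a\}}=\{x\in R\mid x\sim a\}$. For $x,y\in C(a)$ put $d(x,y)=\min\{n\ge 0\mid y\sim_n x\}$, and $\operatorname{diam}(C(a))=\sup\{d(x,y)\mid x,y\in C(a)\}\in\mathbb{N}\cup\{\infty\}$. The diameter of the ring $R$ is $\operatorname{diam}(R)=\sup\{\operatorname{diam}(C(a))\mid a\in R\}$.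
   Formalization: The formal theorem assumes in addition that some n_i ≥ 2 or all D_i are fields; if all n_i = 1 and some D_i is noncommutative (e.g. R the quaternions), distinct conjugate elements give diam(R) ≥ 1, while max(n_i − 1) = 0. *)

theory Defs
  imports
    "HOL-Library.Extended_Nat"
    "HOL-Algebra.QuotRing"
    "HOL-Algebra.Chinese_Remainder"
    "Jordan_Normal_Form.Matrix"
begin

section \<open>Division rings, matrix rings and semisimple rings\<close>

locale skew_field = ring +
  assumes zero_not_one: "\<zero> \<noteq> \<one>"
    and skew_field_Units: "Units R = carrier R - {\<zero>}"

text \<open>
  The matrix type of \<open>Jordan_Normal_Form\<close> is used for arbitrary entries; its arithmetic is not,
  because there the entry ring is a type class instance rather than a record.
\<close>

definition matrix_ring :: "nat \<Rightarrow> ('a, 'k) ring_scheme \<Rightarrow> 'a mat ring" where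
  "matrix_ring n D = \<lparr>
     carrier = {A \<in> carrier_mat n n. elements_mat A \<subseteq> carrier D},
     monoid.mult = (\<lambda>A B. mat n n (\<lambda>(i, j). \<Oplus>\<^bsub>D\<^esub>k\<in>{..<n}. A $$ (i, k) \<otimes>\<^bsub>D\<^esub> B $$ (k, j))),
     one = mat n n (\<lambda>(i, j). if i = j then \<one>\<^bsub>D\<^esub> else \<zero>\<^bsub>D\<^esub>),
     zero = mat n n (\<lambda>(i, j). \<zero>\<^bsub>D\<^esub>),
     add = (\<lambda>A B. mat n n (\<lambda>(i, j). A $$ (i, j) \<oplus>\<^bsub>D\<^esub> B $$ (i, j))) \<rparr>"

definition left_ideal :: "'a set \<Rightarrow> ('a, 'k) ring_scheme \<Rightarrow> bool" where
  "left_ideal I R \<longleftrightarrow>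
     additive_subgroup I R \<and> (\<forall>r\<in>carrier R. \<forall>x\<in>I. r \<otimes>\<^bsub>R\<^esub> x \<in> I)"

text \<open>Semisimple as a left module over itself: every submodule is a direct summand.\<close>

definition semisimple_ring :: "('a, 'k) ring_scheme \<Rightarrow> bool" where
  "semisimple_ring R \<longleftrightarrow> ring R \<and>
     (\<forall>I. left_ideal I R \<longrightarrow>
       (\<exists>J. left_ideal J R \<and> I \<inter> J = {\<zero>\<^bsub>R\<^esub>} \<and> I <+>\<^bsub>R\<^esub> J = carrier R))"

section \<open>Commutative closure and diameter\<close>

definition sim1 :: "('a, 'k) ring_scheme \<Rightarrow> 'a \<Rightarrow> 'a \<Rightarrow> bool" where
  "sim1 R a b \<longleftrightarrow>
     (\<exists>c\<in>carrier R. \<exists>d\<in>carrier R. a = c \<otimes>\<^bsub>R\<^esub> d \<and> b = d \<otimes>\<^bsub>R\<^esub> c)"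

text \<open>For elements of a ring, \<open>simn R (Suc 0)\<close> coincides with \<open>sim1 R\<close>.\<close>

primrec simn :: "('a, 'k) ring_scheme \<Rightarrow> nat \<Rightarrow> 'a \<Rightarrow> 'a \<Rightarrow> bool" where
  "simn R 0 a b \<longleftrightarrow> a = b"
| "simn R (Suc n) a b \<longleftrightarrow> (\<exists>c\<in>carrier R. sim1 R a c \<and> simn R n c b)"

definition comm_closure :: "('a, 'k) ring_scheme \<Rightarrow> 'a \<Rightarrow> 'a set" where
  "comm_closure R a = {x \<in> carrier R. \<exists>n. simn R n x a}"

definition comm_dist :: "('a, 'k) ring_scheme \<Rightarrow> 'a \<Rightarrow> 'a \<Rightarrow> nat" where
  "comm_dist R x y = (LEAST n. simn R n y x)"

definition closure_diam :: "('a, 'k) ring_scheme \<Rightarrow> 'a \<Rightarrow> enat" where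
  "closure_diam R a =
     (SUP (x, y) \<in> comm_closure R a \<times> comm_closure R a. enat (comm_dist R x y))"

definition ring_diam :: "('a, 'k) ring_scheme \<Rightarrow> enat" where
  "ring_diam R = (SUP a \<in> carrier R. closure_diam R a)"

text \<open>
  A noncommutative division ring has two distinct conjugate elements, which are at distance 1.
  So although it is its own ring of one by one matrices, its diameter is not zero.
\<close>

lemma one_le_ring_diam_noncommutative:
  assumes "skew_field D" and "\<not> field D"
  shows "1 \<le> ring_diam D"
proof -
  interpret skew_field D by fact
  have "\<not> cring D"
  proof
    assume "cring D"
    then interpret C: cring D .
    have "field D"
      by (rule C.cring_fieldI) (rule skew_field_Units)
    with assms(2) show False ..
  qed
  then obtain u y where uy: "u \<in> carrier D" "y \<in> carrier D"
      and ne: "u \<otimes>\<^bsub>D\<^esub> y \<noteq> y \<otimes>\<^bsub>D\<^esub> u"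
    using cring.intro [OF ring_axioms comm_monoidI] m_assoc m_closed one_closed l_one by blast
  have "u \<noteq> \<zero>\<^bsub>D\<^esub>"
    using ne uy by auto
  then have U: "u \<in> Units D"
    using uy skew_field_Units by auto
  define v where "v = inv\<^bsub>D\<^esub> u"
  have v: "v \<in> carrier D" "v \<otimes>\<^bsub>D\<^esub> u = \<one>\<^bsub>D\<^esub>" "u \<otimes>\<^bsub>D\<^esub> v = \<one>\<^bsub>D\<^esub>"
    using U by (auto simp: v_def)
  define x where "x = u \<otimes>\<^bsub>D\<^esub> y \<otimes>\<^bsub>D\<^esub> v"
  have x: "x \<in> carrier D"
    using uy v by (simp add: x_def)
  have "x \<otimes>\<^bsub>D\<^esub> u = u \<otimes>\<^bsub>D\<^esub> y"
    using uy v by (simp add: x_def m_assoc)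
  with ne have xy: "x \<noteq> y"
    by auto
  have "y = v \<otimes>\<^bsub>D\<^esub> (u \<otimes>\<^bsub>D\<^esub> y)"
    using uy v by (simp add: m_assoc [symmetric])
  then have "sim1 D x y"
    using uy v unfolding sim1_def x_def by (metis m_closed)
  then have s: "simn D (Suc 0) x y"
    using uy by simp
  have xC: "x \<in> comm_closure D y"
    unfolding comm_closure_def using x s by blast
  have yC: "y \<in> comm_closure D y"
    unfolding comm_closure_def using uy by (auto intro: exI [of _ 0])
  have "simn D (comm_dist D y x) x y"
    unfolding comm_dist_def by (rule LeastI) (rule s)
  then have "comm_dist D y x \<noteq> 0"
    using xy by (metis simn.simps(1))
  then have "1 \<le> enat (comm_dist D y x)"
    by (simp add: one_enat_def)
  also have "\<dots> \<le> closure_diam D y"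
    unfolding closure_diam_def using xC yC by (auto intro!: SUP_upper2 [of "(y, x)"])
  also have "\<dots> \<le> ring_diam D"
    unfolding ring_diam_def using uy by (auto intro: SUP_upper)
  finally show ?thesis .
qed

end

theory Submission
  imports Defs
begin

text \<open>
  The ring of \<open>n \<times> n\<close> matrices over a division ring acts on \<open>V = D\<^sup>n\<close>. A chain of \<open>\<sim>\<^sub>1\<close> steps
  from \<open>f\<close> to \<open>g\<close> yields a shift equivalence: \<open>f p = p g\<close>, \<open>q f = g q\<close>, \<open>p q = f\<^sup>k\<close>, \<open>q p = g\<^sup>k\<close>.
  If \<open>f\<close> or \<open>g\<close> is invertible, this is a conjugacy. Otherwise let \<open>s\<close> and \<open>t\<close> be their indices,
  the lengths of their longest nilpotent Jordan blocks.
  One step can lower the index by one, and at index one shift equivalence is conjugacy; this joins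
  \<open>f\<close> and \<open>g\<close> in \<open>s + t - 2\<close> steps. As long as the nilpotent part is not a single
  block, one step can also raise the index, and for a single block shift equivalence is again
  conjugacy; this route takes at most \<open>2 n - s - t\<close> steps. Conjugating costs nothing when
  there is at least one step to absorb it, so the shorter route gives
  \<open>max 1 (n - 1)\<close>. The bound \<open>n - 1\<close> is attained between a full nilpotent block and \<open>0\<close>, because a
  step raises the nilpotency index by at most one. In a product, chains are formed componentwise.
\<close>

section \<open>Spaces over a division ring\<close>

text \<open>Split \<open>V\<close> by \<open>f\<close> into an eventual image, where
  \<open>f\<close> is invertible, and an eventual kernel, where it is nilpotent. Shift equivalence
  determines the invertible part up to conjugacy, but of the nilpotent part it sees only the
  dimension. So it becomes conjugacy at the two extremes where a dimension determines a nilpotent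
  map: zero, and a single block. Both serve as meeting places, and the two routes have lengths
  adding up to at most \<open>2 n - 2\<close>, so one of them has length at most
  \<open>n - 1\<close>.

  No normal form over \<open>D\<close> is used. The invertible parts are matched by the intertwiners
  of the shift equivalence, the nilpotent parts by functionals. As \<open>rk\<close> is only
  strictly monotone, dimensions cannot be added; extremal choices and stabilising chains of kernels
  and images take the place of counting.

  The 1 in \<open>max 1 (n - 1)\<close> is a real effect: in a noncommutative division ring
  conjugate elements may differ, although \<open>n - 1 = 0\<close>. This is harmless once some block
  has size at least 2, or if all division rings are fields; \<open>nonexceptional\<close> says just
  that, since in the remaining case the diameter is 1 and not 0.\<close>

text \<open>
  Scalars act on the right, so \<open>a \<odot> x\<close> stands for \<open>x a\<close>. All the dimension theory that is needed
  is a bounded, strictly monotone \<open>rk\<close> on subspaces.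
\<close>

locale right_space = skew_field D + V: abelian_group V
  for D :: "('a, 'k) ring_scheme" (structure)
    and V :: "('a, 'v, 'm) module_scheme" (structure) +
  fixes rk :: "'v set \<Rightarrow> nat" and dm :: nat
  assumes smult_closed [simp, intro]:
      "\<lbrakk>a \<in> carrier D; x \<in> carrier V\<rbrakk> \<Longrightarrow> a \<odot>\<^bsub>V\<^esub> x \<in> carrier V"
    and smult_l_distr:
      "\<lbrakk>a \<in> carrier D; b \<in> carrier D; x \<in> carrier V\<rbrakk> \<Longrightarrow>
        (a \<oplus> b) \<odot>\<^bsub>V\<^esub> x = a \<odot>\<^bsub>V\<^esub> x \<oplus>\<^bsub>V\<^esub> b \<odot>\<^bsub>V\<^esub> x"
    and smult_r_distr:
      "\<lbrakk>a \<in> carrier D; x \<in> carrier V; y \<in> carrier V\<rbrakk> \<Longrightarrow>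
        a \<odot>\<^bsub>V\<^esub> (x \<oplus>\<^bsub>V\<^esub> y) = a \<odot>\<^bsub>V\<^esub> x \<oplus>\<^bsub>V\<^esub> a \<odot>\<^bsub>V\<^esub> y"
    and smult_mult:
      "\<lbrakk>a \<in> carrier D; b \<in> carrier D; x \<in> carrier V\<rbrakk> \<Longrightarrow>
        (a \<otimes> b) \<odot>\<^bsub>V\<^esub> x = b \<odot>\<^bsub>V\<^esub> (a \<odot>\<^bsub>V\<^esub> x)"
    and smult_one [simp]: "x \<in> carrier V \<Longrightarrow> \<one> \<odot>\<^bsub>V\<^esub> x = x"
    and rk_le: "rk W \<le> dm"
    and rk_strict:
      "\<lbrakk>W \<subset> W'; W' \<subseteq> carrier V;
        \<zero>\<^bsub>V\<^esub> \<in> W; \<And>x y. x \<in> W \<Longrightarrow> y \<in> W \<Longrightarrow> x \<oplus>\<^bsub>V\<^esub> y \<in> W;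
        \<And>a x. a \<in> carrier D \<Longrightarrow> x \<in> W \<Longrightarrow> a \<odot>\<^bsub>V\<^esub> x \<in> W;
        \<zero>\<^bsub>V\<^esub> \<in> W'; \<And>x y. x \<in> W' \<Longrightarrow> y \<in> W' \<Longrightarrow> x \<oplus>\<^bsub>V\<^esub> y \<in> W';
        \<And>a x. a \<in> carrier D \<Longrightarrow> x \<in> W' \<Longrightarrow> a \<odot>\<^bsub>V\<^esub> x \<in> W'\<rbrakk> \<Longrightarrow> rk W < rk W'"
begin

section \<open>Scalars, subspaces and linear maps\<close>

lemma smult_zero_left [simp]:
  assumes "x \<in> carrier V" shows "\<zero> \<odot>\<^bsub>V\<^esub> x = \<zero>\<^bsub>V\<^esub>"
proof -
  have "\<zero> \<odot>\<^bsub>V\<^esub> x \<oplus>\<^bsub>V\<^esub> \<zero> \<odot>\<^bsub>V\<^esub> x = \<zero> \<odot>\<^bsub>V\<^esub> x \<oplus>\<^bsub>V\<^esub> \<zero>\<^bsub>V\<^esub>"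
    using smult_l_distr[of \<zero> \<zero> x] assms by simp
  then show ?thesis
    using assms V.add.l_cancel_one[of "\<zero> \<odot>\<^bsub>V\<^esub> x" "\<zero> \<odot>\<^bsub>V\<^esub> x"] by simp
qed

lemma smult_zero_right [simp]:
  assumes "a \<in> carrier D" shows "a \<odot>\<^bsub>V\<^esub> \<zero>\<^bsub>V\<^esub> = \<zero>\<^bsub>V\<^esub>"
  using smult_mult[of \<zero> a "\<zero>\<^bsub>V\<^esub>"] assms by simp

lemma smult_minus_one:
  assumes "x \<in> carrier V" shows "(\<ominus> \<one>) \<odot>\<^bsub>V\<^esub> x = \<ominus>\<^bsub>V\<^esub> x"
proof -
  have "(\<ominus> \<one>) \<odot>\<^bsub>V\<^esub> x \<oplus>\<^bsub>V\<^esub> x = \<zero>\<^bsub>V\<^esub>"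
    using smult_l_distr[of "\<ominus> \<one>" \<one> x] assms by (simp add: l_neg)
  then show ?thesis
    using assms V.minus_equality[of "(\<ominus> \<one>) \<odot>\<^bsub>V\<^esub> x" x] by simp
qed

lemma V_minus_eq: "x \<ominus>\<^bsub>V\<^esub> y = x \<oplus>\<^bsub>V\<^esub> (\<ominus>\<^bsub>V\<^esub> y)"
  by (simp add: V.minus_eq)

lemma V_eq_minus_iff:
  "\<lbrakk>x \<in> carrier V; y \<in> carrier V; z \<in> carrier V\<rbrakk> \<Longrightarrow> x = y \<ominus>\<^bsub>V\<^esub> z \<longleftrightarrow> x \<oplus>\<^bsub>V\<^esub> z = y"
  using V.add.inv_solve_right[of x y z] by (auto simp: V_minus_eq)

lemma V_diff_eq_zero: "\<lbrakk>x \<in> carrier V; y \<in> carrier V\<rbrakk> \<Longrightarrow> x \<ominus>\<^bsub>V\<^esub> y = \<zero>\<^bsub>V\<^esub> \<longleftrightarrow> x = y"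
  using V_eq_minus_iff[of "\<zero>\<^bsub>V\<^esub>" x y] by auto

lemma V_sub_add: "\<lbrakk>x \<in> carrier V; y \<in> carrier V\<rbrakk> \<Longrightarrow> y \<oplus>\<^bsub>V\<^esub> (x \<ominus>\<^bsub>V\<^esub> y) = x"
  using V_eq_minus_iff[of "x \<ominus>\<^bsub>V\<^esub> y" x y] by (simp add: V.a_comm)

lemma obtain_inverse:
  assumes "a \<in> carrier D" "a \<noteq> \<zero>"
  obtains b where "b \<in> carrier D" "a \<otimes> b = \<one>" "b \<otimes> a = \<one>"
proof -
  have "a \<in> Units D" using assms skew_field_Units by blast
  then show ?thesis using that[of "inv a"] by simp
qed

definition subsp :: "'v set \<Rightarrow> bool" where
  "subsp W \<longleftrightarrow> W \<subseteq> carrier V \<and> \<zero>\<^bsub>V\<^esub> \<in> W \<and> (\<forall>x\<in>W. \<forall>y\<in>W. x \<oplus>\<^bsub>V\<^esub> y \<in> W)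
     \<and> (\<forall>a\<in>carrier D. \<forall>x\<in>W. a \<odot>\<^bsub>V\<^esub> x \<in> W)"

lemma subspI:
  assumes "W \<subseteq> carrier V" "\<zero>\<^bsub>V\<^esub> \<in> W" "\<And>x y. x \<in> W \<Longrightarrow> y \<in> W \<Longrightarrow> x \<oplus>\<^bsub>V\<^esub> y \<in> W"
    "\<And>a x. a \<in> carrier D \<Longrightarrow> x \<in> W \<Longrightarrow> a \<odot>\<^bsub>V\<^esub> x \<in> W"
  shows "subsp W"
  using assms unfolding subsp_def by auto

lemma subspD:
  assumes "subsp W"
  shows "W \<subseteq> carrier V" "\<zero>\<^bsub>V\<^esub> \<in> W" "\<And>x y. x \<in> W \<Longrightarrow> y \<in> W \<Longrightarrow> x \<oplus>\<^bsub>V\<^esub> y \<in> W"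
    "\<And>a x. a \<in> carrier D \<Longrightarrow> x \<in> W \<Longrightarrow> a \<odot>\<^bsub>V\<^esub> x \<in> W" "\<And>x. x \<in> W \<Longrightarrow> x \<in> carrier V"
  using assms unfolding subsp_def by auto

lemma subsp_minus:
  assumes "subsp W" "x \<in> W" "y \<in> W" shows "x \<ominus>\<^bsub>V\<^esub> y \<in> W"
proof -
  note S = subspD[OF assms(1)]
  have "x \<ominus>\<^bsub>V\<^esub> y = x \<oplus>\<^bsub>V\<^esub> (\<ominus> \<one>) \<odot>\<^bsub>V\<^esub> y"
    using S(5) assms by (simp add: V_minus_eq smult_minus_one)
  then show ?thesis using S assms by simp
qed

lemma rk_less:
  assumes "subsp W" "subsp W'" "W \<subset> W'" shows "rk W < rk W'"
  using rk_strict[OF assms(3)] subspD[OF assms(1)] subspD[OF assms(2)] by blast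

lemma rk_eqD:
  assumes "subsp W" "subsp W'" "W \<subseteq> W'" "rk W' \<le> rk W" shows "W = W'"
  using rk_less[OF assms(1,2)] assms(3,4) by fastforce

lemma subsp_carrier: "subsp (carrier V)"
  by (rule subspI) auto

definition lin :: "('v \<Rightarrow> 'v) \<Rightarrow> bool" where
  "lin f \<longleftrightarrow> (\<forall>x\<in>carrier V. f x \<in> carrier V)
     \<and> (\<forall>x\<in>carrier V. \<forall>y\<in>carrier V. f (x \<oplus>\<^bsub>V\<^esub> y) = f x \<oplus>\<^bsub>V\<^esub> f y)
     \<and> (\<forall>a\<in>carrier D. \<forall>x\<in>carrier V. f (a \<odot>\<^bsub>V\<^esub> x) = a \<odot>\<^bsub>V\<^esub> f x)"

lemma linI:
  assumes "\<And>x. x \<in> carrier V \<Longrightarrow> f x \<in> carrier V"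
    "\<And>x y. x \<in> carrier V \<Longrightarrow> y \<in> carrier V \<Longrightarrow> f (x \<oplus>\<^bsub>V\<^esub> y) = f x \<oplus>\<^bsub>V\<^esub> f y"
    "\<And>a x. a \<in> carrier D \<Longrightarrow> x \<in> carrier V \<Longrightarrow> f (a \<odot>\<^bsub>V\<^esub> x) = a \<odot>\<^bsub>V\<^esub> f x"
  shows "lin f"
  using assms unfolding lin_def by auto

lemma lin_closed [simp, intro]: "lin f \<Longrightarrow> x \<in> carrier V \<Longrightarrow> f x \<in> carrier V"
  unfolding lin_def by auto

lemma lin_add: "lin f \<Longrightarrow> x \<in> carrier V \<Longrightarrow> y \<in> carrier V \<Longrightarrow> f (x \<oplus>\<^bsub>V\<^esub> y) = f x \<oplus>\<^bsub>V\<^esub> f y"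
  unfolding lin_def by auto

lemma lin_smult: "lin f \<Longrightarrow> a \<in> carrier D \<Longrightarrow> x \<in> carrier V \<Longrightarrow> f (a \<odot>\<^bsub>V\<^esub> x) = a \<odot>\<^bsub>V\<^esub> f x"
  unfolding lin_def by auto

lemma lin_zero [simp]: assumes "lin f" shows "f \<zero>\<^bsub>V\<^esub> = \<zero>\<^bsub>V\<^esub>"
  using lin_smult[OF assms, of \<zero> "\<zero>\<^bsub>V\<^esub>"] assms by simp

lemma lin_minus:
  assumes "lin f" "x \<in> carrier V" "y \<in> carrier V" shows "f (x \<ominus>\<^bsub>V\<^esub> y) = f x \<ominus>\<^bsub>V\<^esub> f y"
  using assms by (simp add: V_minus_eq lin_add lin_smult flip: smult_minus_one)

lemma lin_neg: "lin f \<Longrightarrow> x \<in> carrier V \<Longrightarrow> f (\<ominus>\<^bsub>V\<^esub> x) = \<ominus>\<^bsub>V\<^esub> f x"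
  by (simp add: lin_smult flip: smult_minus_one)

lemma lin_id [simp]: "lin (\<lambda>x. x)"
  by (auto intro: linI)

lemma lin_comp [simp]: "lin f \<Longrightarrow> lin g \<Longrightarrow> lin (\<lambda>x. f (g x))"
  by (auto intro!: linI simp: lin_add lin_smult)

lemma lin_pow [simp]: "lin f \<Longrightarrow> lin (f ^^ k)"
  by (induction k) (auto simp: comp_def id_def)

lemma lin_plus: "lin f \<Longrightarrow> lin g \<Longrightarrow> lin (\<lambda>x. f x \<oplus>\<^bsub>V\<^esub> g x)"
  by (auto intro!: linI simp: lin_add lin_smult smult_r_distr V.a_ac)

definition linf :: "('v \<Rightarrow> 'a) \<Rightarrow> bool" where
  "linf f \<longleftrightarrow> (\<forall>x\<in>carrier V. f x \<in> carrier D)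
     \<and> (\<forall>x\<in>carrier V. \<forall>y\<in>carrier V. f (x \<oplus>\<^bsub>V\<^esub> y) = f x \<oplus> f y)
     \<and> (\<forall>a\<in>carrier D. \<forall>x\<in>carrier V. f (a \<odot>\<^bsub>V\<^esub> x) = f x \<otimes> a)"

lemma linf_closed [simp, intro]: "linf f \<Longrightarrow> x \<in> carrier V \<Longrightarrow> f x \<in> carrier D"
  unfolding linf_def by auto

lemma linf_add: "linf f \<Longrightarrow> x \<in> carrier V \<Longrightarrow> y \<in> carrier V \<Longrightarrow> f (x \<oplus>\<^bsub>V\<^esub> y) = f x \<oplus> f y"
  unfolding linf_def by auto

lemma linf_smult: "linf f \<Longrightarrow> a \<in> carrier D \<Longrightarrow> x \<in> carrier V \<Longrightarrow> f (a \<odot>\<^bsub>V\<^esub> x) = f x \<otimes> a"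
  unfolding linf_def by auto

lemma linf_minus_smult:
  assumes "linf f" "x \<in> carrier V" "y \<in> carrier V" "f y = \<one>"
  shows "f (x \<ominus>\<^bsub>V\<^esub> (f x \<odot>\<^bsub>V\<^esub> y)) = \<zero>"
proof -
  have "x \<ominus>\<^bsub>V\<^esub> (f x \<odot>\<^bsub>V\<^esub> y) = x \<oplus>\<^bsub>V\<^esub> (\<ominus> \<one>) \<odot>\<^bsub>V\<^esub> (f x \<odot>\<^bsub>V\<^esub> y)"
    using assms by (simp add: V_minus_eq smult_minus_one)
  then show ?thesis using assms by (simp add: linf_add linf_smult r_minus r_neg)
qed

lemma linf_comp: "linf \<phi> \<Longrightarrow> lin f \<Longrightarrow> linf (\<lambda>x. \<phi> (f x))"
  by (auto simp: linf_def lin_add lin_smult)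

lemma lin_rank_one: "linf \<phi> \<Longrightarrow> w \<in> carrier V \<Longrightarrow> lin (\<lambda>x. \<phi> x \<odot>\<^bsub>V\<^esub> w)"
  by (auto intro!: linI simp: linf_add linf_smult smult_l_distr smult_mult)

lemma lin_diff: assumes "lin f" "lin g" shows "lin (\<lambda>x. f x \<ominus>\<^bsub>V\<^esub> g x)"
proof -
  have "lin (\<lambda>x. (\<ominus> \<one>) \<odot>\<^bsub>V\<^esub> g x)"
    using assms by (auto intro!: linI simp: lin_add lin_smult smult_r_distr l_minus r_minus simp flip: smult_mult)
  then have 1: "lin (\<lambda>x. f x \<oplus>\<^bsub>V\<^esub> (\<ominus> \<one>) \<odot>\<^bsub>V\<^esub> g x)"
    by (rule lin_plus[OF assms(1)])
  show ?thesis
    by (rule linI) (use assms lin_add[OF 1] lin_smult[OF 1] in \<open>simp_all add: V_minus_eq smult_minus_one\<close>)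
qed

definition ker :: "('v \<Rightarrow> 'v) \<Rightarrow> 'v set" where
  "ker f = {x \<in> carrier V. f x = \<zero>\<^bsub>V\<^esub>}"

lemma subsp_ker: "lin f \<Longrightarrow> subsp (ker f)"
  by (auto simp: ker_def lin_add lin_smult intro!: subspI)

lemma subsp_image:
  assumes "lin f" "subsp W" shows "subsp (f ` W)"
proof (rule subspI)
  note W = subspD[OF assms(2)]
  show "f ` W \<subseteq> carrier V" using assms W by auto
  show "\<zero>\<^bsub>V\<^esub> \<in> f ` W" using assms W by (metis imageI lin_zero)
  show "x \<oplus>\<^bsub>V\<^esub> y \<in> f ` W" if xy: "x \<in> f ` W" "y \<in> f ` W" for x y
  proof -
    obtain u v where "u \<in> W" "v \<in> W" "x = f u" "y = f v" using xy by auto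
    then show ?thesis using assms W lin_add by (metis imageI)
  qed
  show "a \<odot>\<^bsub>V\<^esub> x \<in> f ` W" if ax: "a \<in> carrier D" "x \<in> f ` W" for a x
  proof -
    obtain u where "u \<in> W" "x = f u" using ax by auto
    then show ?thesis using assms W ax lin_smult by (metis imageI)
  qed
qed

section \<open>Hyperplanes, functionals and projections\<close>

definition adjoin :: "'v set \<Rightarrow> 'v \<Rightarrow> 'v set" where
  "adjoin W x = {w \<oplus>\<^bsub>V\<^esub> a \<odot>\<^bsub>V\<^esub> x | w a. w \<in> W \<and> a \<in> carrier D}"

lemma adjoinI: "w \<in> W \<Longrightarrow> a \<in> carrier D \<Longrightarrow> w \<oplus>\<^bsub>V\<^esub> a \<odot>\<^bsub>V\<^esub> x \<in> adjoin W x"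
  by (auto simp: adjoin_def)

lemma adjoinE:
  assumes "y \<in> adjoin W x"
  obtains w a where "w \<in> W" "a \<in> carrier D" "y = w \<oplus>\<^bsub>V\<^esub> a \<odot>\<^bsub>V\<^esub> x"
  using assms by (auto simp: adjoin_def)

lemma adjoin_superset: "subsp W \<Longrightarrow> x \<in> carrier V \<Longrightarrow> W \<subseteq> adjoin W x"
  using adjoinI[of _ W \<zero> x] subspD(5) by fastforce

lemma adjoin_self: "subsp W \<Longrightarrow> x \<in> carrier V \<Longrightarrow> x \<in> adjoin W x"
  using adjoinI[of "\<zero>\<^bsub>V\<^esub>" W \<one> x] subspD(2) by fastforce

lemma subsp_adjoin:
  assumes W: "subsp W" and x: "x \<in> carrier V" shows "subsp (adjoin W x)"
proof (rule subspI)
  note S = subspD[OF W]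
  show "adjoin W x \<subseteq> carrier V" using S x by (auto simp: adjoin_def)
  show "\<zero>\<^bsub>V\<^esub> \<in> adjoin W x" using adjoin_superset[OF W x] S by auto
  show "u \<oplus>\<^bsub>V\<^esub> v \<in> adjoin W x" if "u \<in> adjoin W x" "v \<in> adjoin W x" for u v
  proof -
    from that obtain w a w' a' where *: "w \<in> W" "a \<in> carrier D" "u = w \<oplus>\<^bsub>V\<^esub> a \<odot>\<^bsub>V\<^esub> x"
      "w' \<in> W" "a' \<in> carrier D" "v = w' \<oplus>\<^bsub>V\<^esub> a' \<odot>\<^bsub>V\<^esub> x"
      by (meson adjoinE)
    then have "u \<oplus>\<^bsub>V\<^esub> v = (w \<oplus>\<^bsub>V\<^esub> w') \<oplus>\<^bsub>V\<^esub> (a \<oplus> a') \<odot>\<^bsub>V\<^esub> x"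
      using S x by (simp add: smult_l_distr V.a_ac)
    then show ?thesis using * S by (simp add: adjoinI)
  qed
  show "b \<odot>\<^bsub>V\<^esub> u \<in> adjoin W x" if b: "b \<in> carrier D" "u \<in> adjoin W x" for b u
  proof -
    from b obtain w a where *: "w \<in> W" "a \<in> carrier D" "u = w \<oplus>\<^bsub>V\<^esub> a \<odot>\<^bsub>V\<^esub> x"
      by (meson adjoinE)
    then have "b \<odot>\<^bsub>V\<^esub> u = b \<odot>\<^bsub>V\<^esub> w \<oplus>\<^bsub>V\<^esub> (a \<otimes> b) \<odot>\<^bsub>V\<^esub> x"
      using S x b by (simp add: smult_r_distr smult_mult)
    then show ?thesis using * S b by (simp add: adjoinI)
  qed
qed

text \<open>A subspace maximal among those containing \<open>W\<close> but not \<open>x\<close> is a hyperplane complementing \<open>x\<close>.\<close>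

lemma obtain_functional:
  assumes W: "subsp W" and x: "x \<in> carrier V" "x \<notin> W"
  obtains \<phi> where "linf \<phi>" "\<And>y. y \<in> W \<Longrightarrow> \<phi> y = \<zero>" "\<phi> x = \<one>"
proof -
  let ?P = "\<lambda>M. subsp M \<and> W \<subseteq> M \<and> x \<notin> M"
  \<comment> \<open>Boundedness of \<open>rk\<close> replaces Zorn's lemma: a subspace of largest
    rank is maximal for inclusion.\<close>
  have "\<exists>M. ?P M \<and> (\<forall>N. ?P N \<longrightarrow> rk N \<le> rk M)"
    by (rule ex_has_greatest_nat[of ?P W rk "Suc dm"]) (use W x rk_le in \<open>auto simp: less_Suc_eq_le\<close>)
  then obtain M where M: "subsp M" "W \<subseteq> M" "x \<notin> M"
    and max: "\<And>N. ?P N \<Longrightarrow> rk N \<le> rk M" by blast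
  note S = subspD[OF M(1)]
  have ex: "\<exists>a\<in>carrier D. \<exists>m\<in>M. y = m \<oplus>\<^bsub>V\<^esub> a \<odot>\<^bsub>V\<^esub> x" if y: "y \<in> carrier V" for y
  proof (cases "y \<in> M")
    case True
    then show ?thesis using x y by (intro bexI[of _ \<zero>] bexI[of _ y]) auto
  next
    case False
    have sub: "M \<subset> adjoin M y"
      using False adjoin_superset[OF M(1) y] adjoin_self[OF M(1) y] by blast
    have "rk M < rk (adjoin M y)"
      by (rule rk_less[OF M(1) subsp_adjoin[OF M(1) y] sub])
    \<comment> \<open>By maximality, adjoining \<open>y\<close> must capture \<open>x\<close>. As
      \<open>x\<close> is not in \<open>M\<close>, the coefficient of \<open>y\<close> is nonzero,
      so the equation can be solved for \<open>y\<close>.\<close>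
    then have "x \<in> adjoin M y"
      using max[of "adjoin M y"] subsp_adjoin[OF M(1) y] sub M(2) by force
    then obtain m a where m: "m \<in> M" "a \<in> carrier D" "x = m \<oplus>\<^bsub>V\<^esub> a \<odot>\<^bsub>V\<^esub> y"
      by (rule adjoinE)
    have "a \<noteq> \<zero>" using m x y M S by force
    then obtain b where b: "b \<in> carrier D" "a \<otimes> b = \<one>" using m obtain_inverse[of a] by metis
    have "b \<odot>\<^bsub>V\<^esub> x = b \<odot>\<^bsub>V\<^esub> m \<oplus>\<^bsub>V\<^esub> y"
      using m b y S by (simp add: smult_r_distr flip: smult_mult)
    then have "y = (\<ominus>\<^bsub>V\<^esub> (b \<odot>\<^bsub>V\<^esub> m)) \<oplus>\<^bsub>V\<^esub> b \<odot>\<^bsub>V\<^esub> x"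
      using m b y S by (simp add: V.r_neg1)
    moreover have "\<ominus>\<^bsub>V\<^esub> (b \<odot>\<^bsub>V\<^esub> m) \<in> M"
      using S m b by (metis a_inv_closed one_closed smult_minus_one)
    ultimately show ?thesis using b by blast
  qed
  \<comment> \<open>Two different coefficients would put a nonzero multiple of \<open>x\<close>, and
    hence \<open>x\<close> itself, into \<open>M\<close>.\<close>
  have uniq: "a = a'" if H: "a \<in> carrier D" "a' \<in> carrier D" "m \<in> M" "m' \<in> M"
    and eq: "m \<oplus>\<^bsub>V\<^esub> a \<odot>\<^bsub>V\<^esub> x = m' \<oplus>\<^bsub>V\<^esub> a' \<odot>\<^bsub>V\<^esub> x" for a a' m m'
  proof (rule ccontr)
    assume "a \<noteq> a'"
    then have ne: "a \<ominus> a' \<noteq> \<zero>" using that add.inv_solve_right[of \<zero> a a'] by (auto simp: minus_eq)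
    obtain b where b: "b \<in> carrier D" "(a \<ominus> a') \<otimes> b = \<one>"
      by (rule obtain_inverse[of "a \<ominus> a'"]) (use H ne in auto)
    have "(a \<ominus> a') \<odot>\<^bsub>V\<^esub> x \<oplus>\<^bsub>V\<^esub> a' \<odot>\<^bsub>V\<^esub> x = a \<odot>\<^bsub>V\<^esub> x"
      using that x by (simp add: minus_eq a_assoc l_neg flip: smult_l_distr)
    then have "m \<oplus>\<^bsub>V\<^esub> (a \<ominus> a') \<odot>\<^bsub>V\<^esub> x \<oplus>\<^bsub>V\<^esub> a' \<odot>\<^bsub>V\<^esub> x = m' \<oplus>\<^bsub>V\<^esub> a' \<odot>\<^bsub>V\<^esub> x"
      using that x S by (simp add: V.a_assoc)
    then have "m \<oplus>\<^bsub>V\<^esub> (a \<ominus> a') \<odot>\<^bsub>V\<^esub> x = m'"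
      using that x S by simp
    then have "(a \<ominus> a') \<odot>\<^bsub>V\<^esub> x = m' \<ominus>\<^bsub>V\<^esub> m"
      using that x S by (subst V_eq_minus_iff) (auto simp: V.a_comm)
    then have "(a \<ominus> a') \<odot>\<^bsub>V\<^esub> x \<in> M" using subsp_minus[OF M(1)] that by simp
    then have "b \<odot>\<^bsub>V\<^esub> ((a \<ominus> a') \<odot>\<^bsub>V\<^esub> x) \<in> M" using S b by blast
    then show False using M b that x by (simp flip: smult_mult)
  qed
  define \<phi> where "\<phi> y = (SOME a. a \<in> carrier D \<and> (\<exists>m\<in>M. y = m \<oplus>\<^bsub>V\<^esub> a \<odot>\<^bsub>V\<^esub> x))" for y
  have \<phi>: "\<phi> y \<in> carrier D \<and> (\<exists>m\<in>M. y = m \<oplus>\<^bsub>V\<^esub> \<phi> y \<odot>\<^bsub>V\<^esub> x)" if "y \<in> carrier V" for y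
    unfolding \<phi>_def by (rule someI_ex) (use ex[OF that] in blast)
  have eqI: "\<phi> y = a" if "a \<in> carrier D" "m \<in> M" "y = m \<oplus>\<^bsub>V\<^esub> a \<odot>\<^bsub>V\<^esub> x" for y a m
  proof -
    have "y \<in> carrier V" using that x S by auto
    then show ?thesis using \<phi>[of y] uniq[of "\<phi> y" a _ m] that by metis
  qed
  have "linf \<phi>"
    unfolding linf_def
  proof (intro conjI ballI)
    fix y assume y: "y \<in> carrier V"
    then show "\<phi> y \<in> carrier D" using \<phi> by auto
    obtain m where m: "m \<in> M" "y = m \<oplus>\<^bsub>V\<^esub> \<phi> y \<odot>\<^bsub>V\<^esub> x" using \<phi> y by auto
    {
      fix z assume z: "z \<in> carrier V"
      obtain m' where m': "m' \<in> M" "z = m' \<oplus>\<^bsub>V\<^esub> \<phi> z \<odot>\<^bsub>V\<^esub> x" using \<phi> z by auto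
      have c: "\<phi> y \<in> carrier D" "\<phi> z \<in> carrier D" using \<phi> y z by auto
      have "y \<oplus>\<^bsub>V\<^esub> z = (m \<oplus>\<^bsub>V\<^esub> \<phi> y \<odot>\<^bsub>V\<^esub> x) \<oplus>\<^bsub>V\<^esub> (m' \<oplus>\<^bsub>V\<^esub> \<phi> z \<odot>\<^bsub>V\<^esub> x)"
        by (rule arg_cong2[OF m(2) m'(2)])
      also have "\<dots> = (m \<oplus>\<^bsub>V\<^esub> m') \<oplus>\<^bsub>V\<^esub> (\<phi> y \<oplus> \<phi> z) \<odot>\<^bsub>V\<^esub> x"
        using m(1) m'(1) c x S by (simp add: smult_l_distr V.a_ac)
      finally show "\<phi> (y \<oplus>\<^bsub>V\<^esub> z) = \<phi> y \<oplus> \<phi> z"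
        by (intro eqI[of _ "m \<oplus>\<^bsub>V\<^esub> m'"]) (use m(1) m'(1) c S in auto)
    }
    fix a assume a: "a \<in> carrier D"
    have c: "\<phi> y \<in> carrier D" using \<phi> y by auto
    have "a \<odot>\<^bsub>V\<^esub> y = a \<odot>\<^bsub>V\<^esub> (m \<oplus>\<^bsub>V\<^esub> \<phi> y \<odot>\<^bsub>V\<^esub> x)" by (rule arg_cong[OF m(2)])
    also have "\<dots> = a \<odot>\<^bsub>V\<^esub> m \<oplus>\<^bsub>V\<^esub> (\<phi> y \<otimes> a) \<odot>\<^bsub>V\<^esub> x"
      using m(1) a c x S by (simp add: smult_r_distr smult_mult)
    finally show "\<phi> (a \<odot>\<^bsub>V\<^esub> y) = \<phi> y \<otimes> a"
      by (intro eqI[of _ "a \<odot>\<^bsub>V\<^esub> m"]) (use m(1) a c S in auto)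
  qed
  moreover have "\<phi> y = \<zero>" if "y \<in> W" for y
    by (rule eqI[of _ y]) (use that M S x in auto)
  moreover have "\<phi> x = \<one>"
    by (rule eqI[of _ "\<zero>\<^bsub>V\<^esub>"]) (use M S x in auto)
  ultimately show ?thesis using that by blast
qed

text \<open>Take an idempotent fixing \<open>W\<close> whose image has least rank, starting from the
  identity. If the image still contained some \<open>e x\<close> outside \<open>W\<close>, a
  functional that is 1 at \<open>e x\<close> and vanishes on \<open>W\<close> would split off that
  direction and leave a smaller image.\<close>

lemma obtain_projection:
  assumes W: "subsp W"
  obtains e where "lin e" "\<And>x. x \<in> carrier V \<Longrightarrow> e x \<in> W" "\<And>x. x \<in> W \<Longrightarrow> e x = x"
proof -
  let ?P = "\<lambda>e. lin e \<and> (\<forall>x\<in>W. e x = x) \<and> (\<forall>x\<in>carrier V. e (e x) = e x)"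
  have "\<exists>e. ?P e \<and> (\<forall>f. ?P f \<longrightarrow> rk (e ` carrier V) \<le> rk (f ` carrier V))"
    using ex_has_least_nat[of ?P "\<lambda>x. x" "\<lambda>e. rk (e ` carrier V)"] by auto
  then obtain e where e: "lin e" "\<And>x. x \<in> W \<Longrightarrow> e x = x" "\<And>x. x \<in> carrier V \<Longrightarrow> e (e x) = e x"
    and min: "\<And>f. ?P f \<Longrightarrow> rk (e ` carrier V) \<le> rk (f ` carrier V)" by blast
  have "e x \<in> W" if x: "x \<in> carrier V" for x
  proof (rule ccontr)
    assume n: "e x \<notin> W"
    obtain \<phi> where \<phi>: "linf \<phi>" "\<And>y. y \<in> W \<Longrightarrow> \<phi> y = \<zero>" "\<phi> (e x) = \<one>"
      using obtain_functional[OF W _ n] x e by auto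
    define f where "f y = e y \<ominus>\<^bsub>V\<^esub> \<phi> (e y) \<odot>\<^bsub>V\<^esub> e x" for y
    have lf: "lin f" unfolding f_def
      using lin_diff[OF e(1) lin_rank_one[OF linf_comp[OF \<phi>(1) e(1)], of "e x"]] e x by simp
    have fW: "f y = y" if "y \<in> W" for y
      using that subspD[OF W] e x by (simp add: f_def \<phi> V_minus_eq)
    have ef: "e (f y) = f y" if "y \<in> carrier V" for y
      using that e x \<phi> by (simp add: f_def lin_minus lin_smult)
    have \<phi>f: "\<phi> (f y) = \<zero>" if "y \<in> carrier V" for y
      unfolding f_def using linf_minus_smult[OF \<phi>(1) _ _ \<phi>(3)] that e x by simp
    have ff: "f (f y) = f y" if y: "y \<in> carrier V" for y
      unfolding f_def[of "f y"] ef[OF y] \<phi>f[OF y] using y x e(1) lf by (simp add: V_minus_eq)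
    have "f y \<in> e ` carrier V" if "y \<in> carrier V" for y
      by (rule image_eqI[of _ e "f y"]) (use ef lf that in auto)
    then have "f ` carrier V \<subseteq> e ` carrier V" by blast
    moreover have "e x \<in> e ` carrier V - f ` carrier V"
      using x \<phi>f \<phi>(3) zero_not_one by fastforce
    ultimately have "rk (f ` carrier V) < rk (e ` carrier V)"
      by (intro rk_less subsp_image lf e subsp_carrier) blast
    then show False using min[of f] lf fW ff by (simp add: not_less[symmetric])
  qed
  then show ?thesis using that e by blast
qed

section \<open>Stabilising kernels and images\<close>

lemma pow_closed [simp]: "lin f \<Longrightarrow> x \<in> carrier V \<Longrightarrow> (f ^^ k) x \<in> carrier V"
  by simp

lemma ker_pow_mono:
  assumes "lin f" "i \<le> j" shows "ker (f ^^ i) \<subseteq> ker (f ^^ j)"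
proof
  fix x assume x: "x \<in> ker (f ^^ i)"
  have "(f ^^ j) x = (f ^^ (j - i)) ((f ^^ i) x)"
    using assms(2) by (metis add.commute comp_apply funpow_add le_add_diff_inverse)
  then show "x \<in> ker (f ^^ j)" using x assms by (auto simp: ker_def)
qed

text \<open>The vector \<open>(f ^^ (k - Suc j)) v\<close> is killed by \<open>f ^^ Suc j\<close>
  but not by \<open>f ^^ j\<close>, so the kernels grow strictly \<open>k\<close> times below the
  bound \<open>dm\<close>. For \<open>k = 0\<close> the two conditions on \<open>v\<close>
  contradict each other.\<close>

lemma index_le:
  assumes f: "lin f" and v: "v \<in> carrier V" "(f ^^ k) v = \<zero>\<^bsub>V\<^esub>" "(f ^^ (k - 1)) v \<noteq> \<zero>\<^bsub>V\<^esub>"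
  shows "k \<le> dm"
proof -
  have "j \<le> k \<Longrightarrow> j \<le> rk (ker (f ^^ j))" for j
  proof (induction j)
    case (Suc j)
    let ?u = "(f ^^ (k - Suc j)) v"
    have 1: "(f ^^ Suc j) ?u = \<zero>\<^bsub>V\<^esub>"
      using v Suc.prems by (metis add.commute comp_apply funpow_add le_add_diff_inverse)
    have "j + (k - Suc j) = k - 1" using Suc.prems by simp
    then have 2: "(f ^^ j) ?u \<noteq> \<zero>\<^bsub>V\<^esub>" using v by (metis comp_apply funpow_add)
    have "ker (f ^^ j) \<subset> ker (f ^^ Suc j)"
      using ker_pow_mono[OF f, of j "Suc j"] 1 2 f v by (auto simp: ker_def)
    then have "rk (ker (f ^^ j)) < rk (ker (f ^^ Suc j))"
      by (intro rk_less subsp_ker lin_pow f)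
    moreover have "j \<le> rk (ker (f ^^ j))" using Suc by simp
    ultimately show ?case by linarith
  qed simp
  from this[OF order_refl] show ?thesis using rk_le[of "ker (f ^^ k)"] by linarith
qed

lemma ker_stable:
  assumes f: "lin f"
  shows "\<exists>k. ker (f ^^ Suc k) \<subseteq> ker (f ^^ k)"
proof (rule ccontr)
  assume "\<not> ?thesis"
  then obtain x where "x \<in> ker (f ^^ Suc (Suc dm))" "x \<notin> ker (f ^^ Suc dm)" by blast
  then show False using index_le[OF f, of x "Suc (Suc dm)"] by (auto simp: ker_def)
qed

text \<open>Where the kernels have become stable, at exponent \<open>k\<close>, write an element of
  the kernel as \<open>(f ^^ k) y\<close>; then \<open>y\<close> lies in the next kernel, hence
  already in this one.\<close>

lemma surj_imp_inj:
  assumes f: "lin f" and surj: "carrier V \<subseteq> f ` carrier V" shows "ker f \<subseteq> {\<zero>\<^bsub>V\<^esub>}"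
proof
  fix x assume x: "x \<in> ker f"
  obtain k where k: "ker (f ^^ Suc k) \<subseteq> ker (f ^^ k)" using ker_stable[OF f] by blast
  have "\<exists>y\<in>carrier V. x = (f ^^ j) y" for j
  proof (induction j)
    case 0 then show ?case using x by (auto simp: ker_def)
  next
    case (Suc j)
    then obtain y where y: "y \<in> carrier V" "x = (f ^^ j) y" by blast
    obtain z where "z \<in> carrier V" "y = f z" using surj y by blast
    then show ?case using y by (metis comp_apply funpow_Suc_right)
  qed
  then obtain y where y: "y \<in> carrier V" "x = (f ^^ k) y" by blast
  then have "y \<in> ker (f ^^ Suc k)" using x by (auto simp: ker_def)
  then show "x \<in> {\<zero>\<^bsub>V\<^esub>}" using k y by (auto simp: ker_def)
qed

lemma im_stable:
  assumes f: "lin f"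
  shows "\<exists>k. (f ^^ k) ` carrier V \<subseteq> (f ^^ Suc k) ` carrier V"
proof -
  obtain k where k: "\<And>j. rk ((f ^^ k) ` carrier V) \<le> rk ((f ^^ j) ` carrier V)"
    using ex_has_least_nat[of "\<lambda>_. True" 0 "\<lambda>j. rk ((f ^^ j) ` carrier V)"] by auto
  have "(f ^^ Suc k) x \<in> (f ^^ k) ` carrier V" if "x \<in> carrier V" for x
    by (rule image_eqI[of _ _ "f x"]) (use f that in \<open>auto simp: funpow_swap1\<close>)
  then have "(f ^^ Suc k) ` carrier V \<subseteq> (f ^^ k) ` carrier V"
    by blast
  then have "(f ^^ Suc k) ` carrier V = (f ^^ k) ` carrier V"
    by (rule rk_eqD[rotated 2]) (intro subsp_image lin_pow f subsp_carrier k)+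
  then show ?thesis by blast
qed

lemma lin_injD:
  assumes "lin f" "ker f \<subseteq> {\<zero>\<^bsub>V\<^esub>}" "x \<in> carrier V" "y \<in> carrier V" "f x = f y"
  shows "x = y"
proof -
  have "x \<ominus>\<^bsub>V\<^esub> y \<in> ker f" using assms by (simp add: ker_def lin_minus V_diff_eq_zero)
  then show ?thesis using assms V_diff_eq_zero by blast
qed

text \<open>Dual to the previous argument: where the images are stable, \<open>(f ^^ k) x\<close>
  equals \<open>(f ^^ k) (f y)\<close>, and the injective power cancels.\<close>

lemma inj_imp_surj:
  assumes f: "lin f" and inj: "ker f \<subseteq> {\<zero>\<^bsub>V\<^esub>}" shows "carrier V \<subseteq> f ` carrier V"
proof
  fix x assume x: "x \<in> carrier V"
  obtain k where k: "(f ^^ k) ` carrier V \<subseteq> (f ^^ Suc k) ` carrier V"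
    using im_stable[OF f] by blast
  then obtain y where y: "y \<in> carrier V" "(f ^^ k) x = (f ^^ k) (f y)"
    using x by (force simp del: funpow.simps simp: funpow_Suc_right)
  have "ker (f ^^ k) \<subseteq> {\<zero>\<^bsub>V\<^esub>}"
  proof (induction k)
    case (Suc k)
    have "(f ^^ k) x \<in> ker f" if "x \<in> ker (f ^^ Suc k)" for x
      using that f by (simp add: ker_def)
    then have "ker (f ^^ Suc k) \<subseteq> ker (f ^^ k)" using inj by (force simp: ker_def)
    then show ?case using Suc.IH by blast
  qed (auto simp: ker_def)
  then have "x = f y" using lin_injD[of "f ^^ k" x "f y"] f x y by simp
  then show "x \<in> f ` carrier V" using y by blast
qed

section \<open>Chains of endomorphisms\<close>

text \<open>
  The ring is that of endomorphisms of \<open>V\<close>; its elements are represented by functions whose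
  values outside the carrier are irrelevant.
\<close>

definition sim :: "('v \<Rightarrow> 'v) \<Rightarrow> ('v \<Rightarrow> 'v) \<Rightarrow> bool" where
  "sim f g \<longleftrightarrow> (\<exists>c d. lin c \<and> lin d \<and> (\<forall>x\<in>carrier V. f x = c (d x)) \<and> (\<forall>x\<in>carrier V. g x = d (c x)))"

primrec chain :: "nat \<Rightarrow> ('v \<Rightarrow> 'v) \<Rightarrow> ('v \<Rightarrow> 'v) \<Rightarrow> bool" where
  "chain 0 f g \<longleftrightarrow> (\<forall>x\<in>carrier V. f x = g x)"
| "chain (Suc k) f g \<longleftrightarrow> (\<exists>h. lin h \<and> sim f h \<and> chain k h g)"

definition conjugate_maps :: "('v \<Rightarrow> 'v) \<Rightarrow> ('v \<Rightarrow> 'v) \<Rightarrow> bool" where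
  "conjugate_maps f g \<longleftrightarrow> (\<exists>t s. lin t \<and> lin s \<and> (\<forall>x\<in>carrier V. s (t x) = x)
     \<and> (\<forall>x\<in>carrier V. t (s x) = x) \<and> (\<forall>x\<in>carrier V. f (t x) = t (g x)))"

text \<open>This is shift equivalence of lag \<open>k\<close> as known from symbolic dynamics;
  chains play the role of strong shift equivalence there.\<close>

definition shift_equiv :: "('v \<Rightarrow> 'v) \<Rightarrow> ('v \<Rightarrow> 'v) \<Rightarrow> bool" where
  "shift_equiv f g \<longleftrightarrow> (\<exists>k p q. lin p \<and> lin q
     \<and> (\<forall>x\<in>carrier V. f (p x) = p (g x)) \<and> (\<forall>x\<in>carrier V. q (f x) = g (q x))
     \<and> (\<forall>x\<in>carrier V. p (q x) = (f ^^ k) x) \<and> (\<forall>x\<in>carrier V. q (p x) = (g ^^ k) x))"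

section \<open>Absorbing conjugations into chains\<close>

lemma simI:
  assumes "lin c" "lin d" "\<And>x. x \<in> carrier V \<Longrightarrow> f x = c (d x)" "\<And>x. x \<in> carrier V \<Longrightarrow> g x = d (c x)"
  shows "sim f g"
  using assms unfolding sim_def by blast

lemma sim_refl: "lin f \<Longrightarrow> sim f f"
  by (rule simI[of "\<lambda>x. x" f]) auto

lemma sim_sym: "sim f g \<Longrightarrow> sim g f"
  unfolding sim_def by blast

lemma sim_cong:
  "sim f g \<Longrightarrow> (\<And>x. x \<in> carrier V \<Longrightarrow> f' x = f x) \<Longrightarrow> (\<And>x. x \<in> carrier V \<Longrightarrow> g' x = g x) \<Longrightarrow> sim f' g'"
  unfolding sim_def by fastforce

lemma lin_inverse:
  assumes t: "lin t" "ker t \<subseteq> {\<zero>\<^bsub>V\<^esub>}"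
  obtains s where "lin s" "\<And>x. x \<in> carrier V \<Longrightarrow> s (t x) = x" "\<And>x. x \<in> carrier V \<Longrightarrow> t (s x) = x"
proof -
  define s where "s x = (SOME y. y \<in> carrier V \<and> t y = x)" for x
  have s: "s x \<in> carrier V \<and> t (s x) = x" if "x \<in> carrier V" for x
    unfolding s_def by (rule someI_ex) (use inj_imp_surj[OF t] that in blast)
  have eqI: "s x = y" if "x \<in> carrier V" "y \<in> carrier V" "t y = x" for x y
    using lin_injD[OF t, of "s x" y] s that by simp
  have "lin s"
    by (rule linI) (use s t in \<open>auto intro!: eqI simp: lin_add lin_smult\<close>)
  moreover have "s (t x) = x" if "x \<in> carrier V" for x
    by (rule eqI) (use t that in auto)
  ultimately show ?thesis using that s by blast
qed

lemma conjugate_mapsI: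
  assumes "lin t" "ker t \<subseteq> {\<zero>\<^bsub>V\<^esub>}" "\<And>x. x \<in> carrier V \<Longrightarrow> f (t x) = t (g x)"
  shows "conjugate_maps f g"
proof -
  obtain s where "lin s" "\<And>x. x \<in> carrier V \<Longrightarrow> s (t x) = x" "\<And>x. x \<in> carrier V \<Longrightarrow> t (s x) = x"
    using lin_inverse[OF assms(1,2)] by blast
  then show ?thesis unfolding conjugate_maps_def using assms(1,3) by blast
qed

lemma conj_sym: assumes "conjugate_maps f g" "lin f" "lin g" shows "conjugate_maps g f"
proof -
  obtain t s where *: "lin t" "lin s" "\<And>x. x \<in> carrier V \<Longrightarrow> s (t x) = x"
    "\<And>x. x \<in> carrier V \<Longrightarrow> t (s x) = x" "\<And>x. x \<in> carrier V \<Longrightarrow> f (t x) = t (g x)"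
    using assms(1) unfolding conjugate_maps_def by blast
  have "g (s x) = s (f x)" if "x \<in> carrier V" for x
    using that *(2) *(3)[of "g (s x)"] *(4)[of x] *(5)[of "s x"] assms(3) by simp
  then show ?thesis unfolding conjugate_maps_def using *(1-4) by blast
qed

text \<open>The conjugating map disappears into the factors: if \<open>g\<close> is \<open>d\<close>
  after \<open>c\<close>, then \<open>c t\<close> and \<open>s d\<close> factor both
  \<open>f\<close> and \<open>h\<close>.\<close>

lemma sim_conj:
  assumes "sim f g" "conjugate_maps g h" "lin g" "lin h" shows "sim f h"
proof -
  obtain t s where *: "lin t" "lin s" "\<And>x. x \<in> carrier V \<Longrightarrow> s (t x) = x"
    "\<And>x. x \<in> carrier V \<Longrightarrow> t (s x) = x" "\<And>x. x \<in> carrier V \<Longrightarrow> g (t x) = t (h x)"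
    using assms(2) unfolding conjugate_maps_def by blast
  obtain c d where cd: "lin c" "lin d" "\<And>x. x \<in> carrier V \<Longrightarrow> f x = c (d x)"
    "\<And>x. x \<in> carrier V \<Longrightarrow> g x = d (c x)" using assms(1) unfolding sim_def by blast
  show ?thesis
  proof (rule simI[of "\<lambda>x. c (t x)" "\<lambda>x. s (d x)"])
    show "f x = c (t (s (d x)))" if "x \<in> carrier V" for x
      using that cd(2,3) *(4) by simp
    show "h x = s (d (c (t x)))" if "x \<in> carrier V" for x
      using that *(1) *(3)[of "h x"] *(5)[of x] cd(4)[of "t x"] assms(4) by simp
  qed (use * cd in auto)
qed

lemma conj_imp_sim: "conjugate_maps f g \<Longrightarrow> lin f \<Longrightarrow> lin g \<Longrightarrow> sim f g"
  using sim_conj[OF sim_refl] by blast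

lemma conj_cong: assumes "conjugate_maps f g" "\<And>x. x \<in> carrier V \<Longrightarrow> f' x = f x" shows "conjugate_maps f' g"
proof -
  obtain t s where *: "lin t" "lin s" "\<forall>x\<in>carrier V. s (t x) = x"
    "\<forall>x\<in>carrier V. t (s x) = x" "\<forall>x\<in>carrier V. f (t x) = t (g x)"
    using assms(1) unfolding conjugate_maps_def by blast
  then have "\<forall>x\<in>carrier V. f' (t x) = t (g x)" using assms(2) by simp
  then show ?thesis unfolding conjugate_maps_def using *(1-4) by blast
qed

lemma chain_mono: assumes "chain k f g" "lin f" "k \<le> l" shows "chain l f g"
  using assms(3,1,2) by (induction rule: dec_induct) (auto intro: sim_refl)

lemma chain_cong_left: assumes "chain k f g" "\<And>x. x \<in> carrier V \<Longrightarrow> f' x = f x" shows "chain k f' g"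
  using assms sim_cong[of f _ f'] by (cases k) (simp_all, blast)

lemma chain_trans: "chain i f g \<Longrightarrow> chain j g h \<Longrightarrow> chain (i + j) f h"
  by (induction i arbitrary: f) (auto intro: chain_cong_left)

lemma chain_sym: "chain k f g \<Longrightarrow> lin f \<Longrightarrow> lin g \<Longrightarrow> chain k g f"
proof (induction k arbitrary: f)
  case (Suc k)
  then obtain h where h: "lin h" "sim f h" "chain k h g" by auto
  have "chain (k + Suc 0) g f"
    by (rule chain_trans[of k g h]) (use Suc h in \<open>auto intro: sim_sym\<close>)
  then show ?case by simp
qed auto

lemma chain_conj:
  assumes "chain (Suc k) f g" "conjugate_maps g h" "lin g" "lin h" shows "chain (Suc k) f h"
  using assms(1)
proof (induction k arbitrary: f)
  case 0
  then obtain x where x: "lin x" "sim f x" "\<And>y. y \<in> carrier V \<Longrightarrow> x y = g y" by auto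
  then have "conjugate_maps x h" using assms by (auto intro: conj_cong)
  then show ?case using sim_conj[OF x(2)] x assms by auto
next
  case (Suc k)
  obtain x where "lin x" "sim f x" "chain (Suc k) x g"
    using Suc.prems chain.simps(2)[of "Suc k" f g] by blast
  then show ?case using Suc.IH[of x] chain.simps(2)[of "Suc k" f h] by blast
qed

text \<open>A conjugation between two chains is absorbed by the last step of the first or by the
  adjacent step of the second. Only if both chains are empty does it cost a step of its own;
  \<open>1 \<le> n\<close> pays for that.\<close>

lemma chain_conj_chain:
  assumes "chain i f x" "conjugate_maps x y" "chain j y g" "lin f" "lin x" "lin y" "lin g"
    and le: "i + j \<le> n" "1 \<le> n"
  shows "chain n f g"
proof -
  consider (i) i' where "i = Suc i'" | (j) j' where "j = Suc j'" | (z) "i = 0" "j = 0"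
    by (meson not0_implies_Suc)
  then show ?thesis
  proof cases
    case i
    then have "chain i f y" using chain_conj assms by blast
    then show ?thesis using chain_mono[OF chain_trans[OF _ assms(3)]] assms le by blast
  next
    case j
    have "chain j g x"
      using chain_conj[of j' g y x] conj_sym chain_sym assms j by blast
    then have "chain j x g" using chain_sym assms by blast
    then show ?thesis using chain_mono[OF chain_trans[OF assms(1)]] assms le by blast
  next
    case z
    then have "sim f g" using assms conj_imp_sim[of x y] by (auto intro: sim_cong)
    then have "chain (Suc 0) f g" using assms by auto
    then show ?thesis by (rule chain_mono) (use assms le in auto)
  qed
qed

section \<open>From chains to shift equivalence\<close>

lemma intertwine_pow:
  assumes "lin f" "lin g" "lin p" "\<And>x. x \<in> carrier V \<Longrightarrow> f (p x) = p (g x)" "x \<in> carrier V"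
  shows "(f ^^ k) (p x) = p ((g ^^ k) x)"
  by (induction k) (use assms in auto)

text \<open>Each step raises the lag by one: with \<open>f = c d\<close>, \<open>h = d c\<close> and
  \<open>p\<close>, \<open>q\<close> relating \<open>h\<close> to \<open>g\<close>, the maps
  \<open>c p\<close> and \<open>q d\<close> relate \<open>f\<close> to \<open>g\<close>.\<close>

lemma chain_shift_equiv:
  "chain n f g \<Longrightarrow> lin f \<Longrightarrow> lin g \<Longrightarrow> shift_equiv f g"
proof (induction n arbitrary: f)
  case 0
  then show ?case unfolding shift_equiv_def
    by (intro exI[of _ 0] exI[of _ "\<lambda>x. x"]) auto
next
  case (Suc n)
  then obtain h where h: "lin h" "sim f h" "chain n h g" by auto
  obtain p q k where pq0: "lin p" "lin q" "\<forall>x\<in>carrier V. h (p x) = p (g x)"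
    "\<forall>x\<in>carrier V. q (h x) = g (q x)" "\<forall>x\<in>carrier V. p (q x) = (h ^^ k) x"
    "\<forall>x\<in>carrier V. q (p x) = (g ^^ k) x"
    using Suc.IH[OF h(3,1) Suc.prems(3)] unfolding shift_equiv_def by blast
  note pq = pq0(1,2) pq0(3-)[rule_format]
  obtain c d where cd: "lin c" "lin d" "\<And>x. x \<in> carrier V \<Longrightarrow> f x = c (d x)"
    "\<And>x. x \<in> carrier V \<Longrightarrow> h x = d (c x)" using h(2) unfolding sim_def by blast
  have "c ((h ^^ k) x) = (f ^^ k) (c x)" if "x \<in> carrier V" for x
    by (rule intertwine_pow[symmetric]) (use that Suc.prems h cd in auto)
  then have "c (p (q (d x))) = (f ^^ Suc k) x" if "x \<in> carrier V" for x
    using that cd(1,2) pq(5)[of "d x"] Suc.prems(2)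
    by (simp add: cd(3)[symmetric] funpow_swap1)
  moreover have "q (d (c (p x))) = (g ^^ Suc k) x" if "x \<in> carrier V" for x
    using that pq(1,2) Suc.prems by (simp add: cd(4)[symmetric] pq(4,6))
  moreover have "f (c (p x)) = c (p (g x))" if "x \<in> carrier V" for x
    using that pq(1,2) Suc.prems cd(1,2) by (simp add: cd(3) cd(4)[symmetric] pq(3))
  moreover have "q (d (f x)) = g (q (d x))" if "x \<in> carrier V" for x
    using that pq(1,2) Suc.prems cd(1,2) by (simp add: cd(3) cd(4)[symmetric] pq(4))
  ultimately show ?case unfolding shift_equiv_def
    by (intro exI[of _ "Suc k"] exI[of _ "\<lambda>x. c (p x)"] exI[of _ "\<lambda>x. q (d x)"]) (use pq cd in auto)
qed

text \<open>Compressing \<open>f\<close> to its image lowers the index.\<close>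

lemma lower_index:
  assumes f: "lin f" and k: "ker (f ^^ Suc (Suc (Suc k))) \<subseteq> ker (f ^^ Suc (Suc k))"
  shows "\<exists>g. lin g \<and> sim f g \<and> ker (g ^^ Suc (Suc k)) \<subseteq> ker (g ^^ Suc k)"
proof -
  obtain e where e: "lin e" "\<And>x. x \<in> carrier V \<Longrightarrow> e x \<in> f ` carrier V"
    "\<And>x. x \<in> f ` carrier V \<Longrightarrow> e x = x"
    using obtain_projection[OF subsp_image[OF f subsp_carrier]] by blast
  have ef: "e (f x) = f x" if "x \<in> carrier V" for x using e that by blast
  let ?g = "\<lambda>x. f (e x)"
  have g: "(?g ^^ Suc j) x = (f ^^ Suc j) (e x)" if "x \<in> carrier V" for j x
    by (induction j) (use that ef e f in auto)
  have "ker (?g ^^ Suc (Suc k)) \<subseteq> ker (?g ^^ Suc k)"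
  proof
    fix x assume x: "x \<in> ker (?g ^^ Suc (Suc k))"
    then have xV: "x \<in> carrier V" by (simp add: ker_def)
    \<comment> \<open>\<open>e x\<close> lies in the image of \<open>f\<close>, so a power of
      \<open>?g\<close> at \<open>x\<close> is the next higher power of \<open>f\<close> at
      \<open>y\<close>. This shift of exponent is the gain of one in the index.\<close>
    obtain y where y: "y \<in> carrier V" "e x = f y" using e(2)[OF xV] by blast
    have pw: "(f ^^ Suc j) y = (f ^^ j) (e x)" for j by (simp add: y(2) funpow_swap1)
    have "y \<in> ker (f ^^ Suc (Suc (Suc k)))"
      using x y(1) g[OF xV, of "Suc k"] pw[of "Suc (Suc k)"] unfolding ker_def by (simp del: funpow.simps)
    then have "y \<in> ker (f ^^ Suc (Suc k))" using k by blast
    then show "x \<in> ker (?g ^^ Suc k)"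
      using xV y(1) g[OF xV, of k] pw[of "Suc k"] unfolding ker_def by (simp del: funpow.simps)
  qed
  moreover have "sim f ?g" by (rule simI[of e f]) (use e f ef in auto)
  ultimately show ?thesis using e f by (intro exI[of _ ?g]) auto
qed

section \<open>Maps of index at most one\<close>

definition index_one :: "('v \<Rightarrow> 'v) \<Rightarrow> bool" where
  "index_one f \<longleftrightarrow> (\<forall>x\<in>carrier V. f (f x) = \<zero>\<^bsub>V\<^esub> \<longrightarrow> f x = \<zero>\<^bsub>V\<^esub>)"

lemma chain_index_one:
  assumes "lin f" "ker (f ^^ Suc (Suc k)) \<subseteq> ker (f ^^ Suc k)"
  shows "\<exists>g. lin g \<and> chain k f g \<and> index_one g"
  using assms
proof (induction k arbitrary: f)
  case 0
  then show ?case by (intro exI[of _ f]) (auto simp: ker_def index_one_def)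
next
  case (Suc k)
  obtain g where "lin g" "sim f g" "ker (g ^^ Suc (Suc k)) \<subseteq> ker (g ^^ Suc k)"
    using lower_index[OF Suc.prems] by blast
  then show ?case using Suc.IH[of g] by (auto simp del: funpow.simps)
qed

lemma index_one_pow:
  assumes "lin f" "index_one f" "x \<in> carrier V" "(f ^^ Suc k) x = \<zero>\<^bsub>V\<^esub>" shows "f x = \<zero>\<^bsub>V\<^esub>"
  using assms(4)
proof (induction k)
  case (Suc k)
  then have "f (f ((f ^^ k) x)) = \<zero>\<^bsub>V\<^esub>" by simp
  then have "f ((f ^^ k) x) = \<zero>\<^bsub>V\<^esub>" using assms unfolding index_one_def by simp
  then show ?case using Suc by simp
qed simp

lemma index_one_decompose:
  assumes f: "lin f" "index_one f" and x: "x \<in> carrier V"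
  obtains y z where "y \<in> carrier V" "z \<in> ker f" "x = f y \<oplus>\<^bsub>V\<^esub> z"
proof -
  obtain k where k: "(f ^^ k) ` carrier V \<subseteq> (f ^^ Suc k) ` carrier V"
    using im_stable[OF f(1)] by blast
  then obtain y where y: "y \<in> carrier V" "(f ^^ k) x = (f ^^ k) (f y)"
    using x by (force simp del: funpow.simps simp: funpow_Suc_right)
  let ?z = "x \<ominus>\<^bsub>V\<^esub> f y"
  have "(f ^^ k) ?z = \<zero>\<^bsub>V\<^esub>" using lin_minus[of "f ^^ k" x "f y"] f x y by (simp add: V_diff_eq_zero)
  then have "(f ^^ Suc k) ?z = \<zero>\<^bsub>V\<^esub>" using f by simp
  moreover have "?z \<in> carrier V" using x y f by simp
  ultimately have "f ?z = \<zero>\<^bsub>V\<^esub>" by (intro index_one_pow[OF f])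
  then show ?thesis using that[of y ?z] x y f by (simp add: ker_def V_sub_add)
qed

lemma index_one_im_pow:
  assumes f: "lin f" "index_one f" and x: "x \<in> carrier V"
  shows "\<exists>y\<in>carrier V. f x = (f ^^ Suc k) y"
proof (induction k)
  case (Suc k)
  then obtain y where y: "y \<in> carrier V" "f x = (f ^^ Suc k) y" by blast
  obtain u z where u: "u \<in> carrier V" "z \<in> ker f" "y = f u \<oplus>\<^bsub>V\<^esub> z" using index_one_decompose[OF f y(1)] .
  then have "f y = f (f u)" using f by (simp add: lin_add ker_def)
  then have "(f ^^ Suc k) y = (f ^^ Suc (Suc k)) u" by (simp del: funpow.simps add: funpow_Suc_right)
  then show ?case using y u by auto
qed (use x in auto)

text \<open>
  An intertwiner that is an isomorphism between the images and has the smallest possible kernel is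
  injective: otherwise a rank one map into the kernel of \<open>f\<close> makes its kernel smaller.
\<close>

lemma index_one_conj:
  assumes f: "lin f" "index_one f" and g: "lin g" "index_one g" and fg: "shift_equiv f g"
  shows "conjugate_maps f g"
proof -
  let ?P = "\<lambda>t. lin t \<and> (\<forall>x\<in>carrier V. f (t x) = t (g x)) \<and> (\<forall>x\<in>carrier V. t (g x) = \<zero>\<^bsub>V\<^esub> \<longrightarrow> g x = \<zero>\<^bsub>V\<^esub>)
    \<and> (\<forall>x\<in>carrier V. \<exists>y\<in>carrier V. f x = t (g y))"
  obtain p q k where pq0: "lin p" "lin q" "\<forall>x\<in>carrier V. f (p x) = p (g x)"
    "\<forall>x\<in>carrier V. q (f x) = g (q x)" "\<forall>x\<in>carrier V. p (q x) = (f ^^ k) x"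
    "\<forall>x\<in>carrier V. q (p x) = (g ^^ k) x"
    using fg unfolding shift_equiv_def by blast
  note pq = pq0(1,2) pq0(3-)[rule_format]
  \<comment> \<open>The composites of \<open>p\<close> and \<open>q\<close> are powers, and at index
    one powers of \<open>g\<close> are injective on its image while powers of \<open>f\<close> have
    the same image as \<open>f\<close>. So \<open>p\<close> already matches the two images; only its
    behaviour outside them may be degenerate.\<close>
  have "?P p"
  proof (intro conjI ballI impI)
    fix x assume x: "x \<in> carrier V"
    show "g x = \<zero>\<^bsub>V\<^esub>" if "p (g x) = \<zero>\<^bsub>V\<^esub>"
    proof (rule index_one_pow[OF g x, of k])
      have "q (p (g x)) = \<zero>\<^bsub>V\<^esub>" using that pq by simp
      then show "(g ^^ Suc k) x = \<zero>\<^bsub>V\<^esub>" using pq(6)[of "g x"] x g by (simp add: funpow_swap1)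
    qed
    obtain y where y: "y \<in> carrier V" "f x = (f ^^ Suc k) y"
      using index_one_im_pow[OF f x] by blast
    then have "f x = p (g (q y))" using pq(2) pq(5)[of y] pq(3)[of "q y"] by simp
    then show "\<exists>y\<in>carrier V. f x = p (g y)" using y pq(2) by blast
  qed (use pq in auto)
  then obtain t where t: "?P t" and min: "\<And>t'. ?P t' \<Longrightarrow> rk (ker t) \<le> rk (ker t')"
    using ex_has_least_nat[of ?P p "\<lambda>t. rk (ker t)"] by blast
  have lt: "lin t" and ft: "\<And>x. x \<in> carrier V \<Longrightarrow> f (t x) = t (g x)"
    and tg: "\<And>x. x \<in> carrier V \<Longrightarrow> t (g x) = \<zero>\<^bsub>V\<^esub> \<Longrightarrow> g x = \<zero>\<^bsub>V\<^esub>"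
    and im: "\<And>x. x \<in> carrier V \<Longrightarrow> \<exists>y\<in>carrier V. f x = t (g y)" using t by auto
  have "ker t \<subseteq> {\<zero>\<^bsub>V\<^esub>}"
  proof (rule ccontr)
    assume nk: "\<not> ?thesis"
    then obtain x where x: "x \<in> carrier V" "t x = \<zero>\<^bsub>V\<^esub>" "x \<noteq> \<zero>\<^bsub>V\<^esub>" by (auto simp: ker_def)
    \<comment> \<open>A map that is not injective misses some vector. Its component in the image of
      \<open>f\<close> is attained by \<open>t\<close>, so its component \<open>y\<close> in
      \<open>ker f\<close> must be missed as well.\<close>
    obtain y0 where y0: "y0 \<in> carrier V" "y0 \<notin> t ` carrier V"
      using surj_imp_inj[OF lt] nk by blast
    obtain u y where u: "u \<in> carrier V" "y \<in> ker f" "y0 = f u \<oplus>\<^bsub>V\<^esub> y" using index_one_decompose[OF f y0(1)] .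
    obtain w where w: "w \<in> carrier V" "f u = t (g w)" using im[OF u(1)] by blast
    have y: "y \<in> carrier V" "f y = \<zero>\<^bsub>V\<^esub>" using u by (auto simp: ker_def)
    have yn: "y \<notin> t ` carrier V"
    proof
      assume "y \<in> t ` carrier V"
      then obtain z where z: "z \<in> carrier V" "y = t z" by blast
      then have "y0 = t (g w \<oplus>\<^bsub>V\<^esub> z)" using u w lt g by (simp add: lin_add)
      then show False using y0 w z g by blast
    qed
    have "x \<notin> g ` carrier V" using x tg by auto
    then obtain \<phi> where \<phi>0: "linf \<phi>" "\<And>z. z \<in> g ` carrier V \<Longrightarrow> \<phi> z = \<zero>" "\<phi> x = \<one>"
      using obtain_functional[OF subsp_image[OF g(1) subsp_carrier] x(1)] by blast
    have \<phi>: "linf \<phi>" "\<And>z. z \<in> carrier V \<Longrightarrow> \<phi> (g z) = \<zero>" "\<phi> x = \<one>"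
      using \<phi>0 by auto
    \<comment> \<open>The correction is invisible to the conditions on \<open>t\<close>:
      \<open>\<phi>\<close> vanishes on the image of \<open>g\<close>, and \<open>f\<close> kills
      \<open>y\<close>.\<close>
    define t' where "t' z = t z \<oplus>\<^bsub>V\<^esub> \<phi> z \<odot>\<^bsub>V\<^esub> y" for z
    have lt': "lin t'" unfolding t'_def using lin_plus[OF lt lin_rank_one[OF \<phi>(1) y(1)]] .
    have t'g: "t' (g z) = t (g z)" if "z \<in> carrier V" for z
      using that \<phi> y lt g by (simp add: t'_def)
    have "f (t' z) = t' (g z)" if "z \<in> carrier V" for z
      using that \<phi>(1) y lt f g ft by (simp add: t'g) (simp add: t'_def lin_add lin_smult)
    then have "?P t'" using lt' t'g tg im by simp
    then have le: "rk (ker t) \<le> rk (ker t')" by (rule min)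
    \<comment> \<open>A nonzero value of \<open>\<phi>\<close> would exhibit \<open>y\<close> as a
      value of \<open>t\<close>.\<close>
    have "ker t' \<subseteq> ker t"
    proof
      fix z assume z: "z \<in> ker t'"
      then have zV: "z \<in> carrier V" and e: "t z \<oplus>\<^bsub>V\<^esub> \<phi> z \<odot>\<^bsub>V\<^esub> y = \<zero>\<^bsub>V\<^esub>" by (auto simp: ker_def t'_def)
      have "\<phi> z = \<zero>"
      proof (rule ccontr)
        assume n: "\<phi> z \<noteq> \<zero>"
        obtain b where b: "b \<in> carrier D" "\<phi> z \<otimes> b = \<one>"
          by (rule obtain_inverse[OF linf_closed[OF \<phi>(1) zV] n])
        have c: "\<phi> z \<in> carrier D" using \<phi> zV by auto
        have "b \<odot>\<^bsub>V\<^esub> (t z \<oplus>\<^bsub>V\<^esub> \<phi> z \<odot>\<^bsub>V\<^esub> y) = \<zero>\<^bsub>V\<^esub>" using e b by simp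
        then have "b \<odot>\<^bsub>V\<^esub> t z \<oplus>\<^bsub>V\<^esub> y = \<zero>\<^bsub>V\<^esub>"
          using b c zV y lt by (simp add: smult_r_distr b(2) flip: smult_mult)
        then have "y = \<ominus>\<^bsub>V\<^esub> (b \<odot>\<^bsub>V\<^esub> t z)"
          using b zV y lt V.minus_equality[of y "b \<odot>\<^bsub>V\<^esub> t z"] by (simp add: V.a_comm)
        also have "\<dots> = t ((\<ominus> \<one>) \<odot>\<^bsub>V\<^esub> (b \<odot>\<^bsub>V\<^esub> z))"
          using b zV lt by (simp add: lin_smult lin_neg smult_minus_one)
        finally show False using yn b zV by (metis imageI a_inv_closed one_closed smult_closed)
      qed
      then show "z \<in> ker t" using e zV y lt by (simp add: ker_def)
    qed
    moreover have "x \<in> ker t" "x \<notin> ker t'"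
    proof -
      show "x \<in> ker t" using x by (simp add: ker_def)
      have "t' x = y" using x y \<phi> by (simp add: t'_def)
      moreover have "y \<noteq> \<zero>\<^bsub>V\<^esub>" using yn lt by (metis V.zero_closed image_eqI lin_zero)
      ultimately show "x \<notin> ker t'" by (simp add: ker_def)
    qed
    ultimately have "rk (ker t') < rk (ker t)" by (intro rk_less subsp_ker lt lt') blast
    then show False using le by simp
  qed
  then show ?thesis using conjugate_mapsI[OF lt] ft by blast
qed

text \<open>
  Here \<open>c\<close> projects along \<open>w\<close>, and \<open>d\<close> agrees with \<open>f\<close> except that it prolongs the string
  \<open>v, f v, \<dots>, f\<^sup>k v\<close> by \<open>w\<close>.
\<close>

lemma raise_index:
  assumes f: "lin f" and v: "v \<in> carrier V" "(f ^^ Suc k) v = \<zero>\<^bsub>V\<^esub>" "(f ^^ k) v \<noteq> \<zero>\<^bsub>V\<^esub>"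
    and w: "w \<in> carrier V" "w \<notin> adjoin (f ` carrier V) v"
  shows "\<exists>g. lin g \<and> sim f g \<and> (g ^^ Suc (Suc k)) v = \<zero>\<^bsub>V\<^esub> \<and> (g ^^ Suc k) v \<noteq> \<zero>\<^bsub>V\<^esub>"
proof -
  have S: "subsp (f ` carrier V)" using f subsp_image subsp_carrier by blast
  \<comment> \<open>\<open>\<psi>\<close> is the coordinate along \<open>w\<close>. Its vanishing on
    the image of \<open>f\<close> gives \<open>c d = f\<close>, and its vanishing at
    \<open>v\<close> keeps the start of the string fixed by \<open>c\<close>. Below,
    \<open>\<phi>\<close> is 1 at the end of the string, where \<open>w\<close> is to be
    attached.\<close>
  obtain \<psi> where \<psi>: "linf \<psi>" "\<And>x. x \<in> adjoin (f ` carrier V) v \<Longrightarrow> \<psi> x = \<zero>" "\<psi> w = \<one>"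
    using obtain_functional[OF subsp_adjoin[OF S v(1)] w] by blast
  have "subsp {\<zero>\<^bsub>V\<^esub>}" by (rule subspI) auto
  then obtain \<phi> where \<phi>: "linf \<phi>" "\<phi> ((f ^^ k) v) = \<one>"
    using obtain_functional[of "{\<zero>\<^bsub>V\<^esub>}" "(f ^^ k) v"] f v by auto
  have \<psi>f: "\<psi> (f x) = \<zero>" if "x \<in> carrier V" for x
    using that \<psi>(2) adjoin_superset[OF S v(1)] by blast
  have \<psi>v: "\<psi> v = \<zero>" using \<psi>(2) adjoin_self[OF S v(1)] by blast
  define c where "c x = x \<ominus>\<^bsub>V\<^esub> \<psi> x \<odot>\<^bsub>V\<^esub> w" for x
  define d where "d x = f x \<oplus>\<^bsub>V\<^esub> \<phi> x \<odot>\<^bsub>V\<^esub> w" for x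
  have c: "lin c" unfolding c_def by (rule lin_diff[OF lin_id lin_rank_one[OF \<psi>(1) w(1)]])
  have d: "lin d" unfolding d_def by (rule lin_plus[OF f lin_rank_one[OF \<phi>(1) w(1)]])
  have cw: "c w = \<zero>\<^bsub>V\<^esub>" using w \<psi> by (simp add: c_def V_diff_eq_zero)
  have cv: "c v = v" using v w \<psi>v by (simp add: c_def V_minus_eq)
  have cf: "c (f x) = f x" if "x \<in> carrier V" for x
    using that \<psi>f w f by (simp add: c_def V_minus_eq)
  have cd: "c (d x) = f x" if "x \<in> carrier V" for x
    using that f w \<phi>(1) cf cw c by (simp add: d_def lin_add lin_smult)
  let ?g = "\<lambda>x. d (c x)"
  \<comment> \<open>The first application of \<open>c\<close> fixes \<open>v\<close>, and every
    later \<open>c\<close> meets a \<open>d\<close> to form \<open>f\<close>, leaving one outermost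
    \<open>d\<close>.\<close>
  have pw: "(?g ^^ Suc j) v = d ((f ^^ j) v)" for j
    by (induction j) (use cd cv v f in auto)
  have 1: "(?g ^^ Suc k) v = w"
    using pw[of k] v w \<phi> unfolding d_def by simp
  moreover have "w \<noteq> \<zero>\<^bsub>V\<^esub>"
    using w subspD(2)[OF subsp_adjoin[OF S v(1)]] by auto
  moreover have "(?g ^^ Suc (Suc k)) v = \<zero>\<^bsub>V\<^esub>"
    using pw[of "Suc k"] v d by (simp del: funpow.simps)
  moreover have "sim f ?g" by (rule simI[OF c d]) (use cd in auto)
  ultimately show ?thesis using c d by (intro exI[of _ ?g]) simp
qed

section \<open>Maps with a single nilpotent block\<close>

text \<open>The last condition bounds the codimension of the image by one, so there is at most one
  nilpotent block. The others say that a string of length \<open>Suc k\<close> starts at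
  \<open>v\<close> and that no longer one exists.\<close>

definition single_block :: "nat \<Rightarrow> 'v \<Rightarrow> ('v \<Rightarrow> 'v) \<Rightarrow> bool" where
  "single_block k v f \<longleftrightarrow> v \<in> carrier V \<and> (f ^^ Suc k) v = \<zero>\<^bsub>V\<^esub> \<and> (f ^^ k) v \<noteq> \<zero>\<^bsub>V\<^esub>
     \<and> ker (f ^^ Suc (Suc k)) \<subseteq> ker (f ^^ Suc k) \<and> carrier V \<subseteq> adjoin (f ` carrier V) v"

text \<open>The number of steps is what \<open>index_le\<close> leaves for the string to grow. If
  \<open>f\<close> is not yet a single block, either a longer string is already there or the image
  and \<open>v\<close> leave room for a vector \<open>w\<close> that prolongs it.\<close>

lemma chain_single_block:
  assumes "lin f" "v \<in> carrier V" "(f ^^ Suc k) v = \<zero>\<^bsub>V\<^esub>" "(f ^^ k) v \<noteq> \<zero>\<^bsub>V\<^esub>"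
  shows "\<exists>g l u. lin g \<and> chain (dm - Suc k) f g \<and> single_block l u g"
  using assms
proof (induction "dm - Suc k" arbitrary: f k v rule: less_induct)
  case (less k f v)
  have k: "Suc k \<le> dm" using index_le[of f v "Suc k"] less.prems by simp
  show ?case
  proof (cases "single_block k v f")
    case True
    moreover have "chain (dm - Suc k) f f"
      by (rule chain_mono[of 0]) (use less.prems in auto)
    ultimately show ?thesis using less.prems by blast
  next
    case False
    have "\<exists>g u. lin g \<and> sim f g \<and> u \<in> carrier V \<and> (g ^^ Suc (Suc k)) u = \<zero>\<^bsub>V\<^esub> \<and> (g ^^ Suc k) u \<noteq> \<zero>\<^bsub>V\<^esub>"
    proof (cases "ker (f ^^ Suc (Suc k)) \<subseteq> ker (f ^^ Suc k)")
      case True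
      then obtain w where "w \<in> carrier V" "w \<notin> adjoin (f ` carrier V) v"
        using False less.prems unfolding single_block_def by blast
      then show ?thesis using raise_index[OF less.prems] less.prems(2) by blast
    next
      case False
      \<comment> \<open>A longer string exists without changing \<open>f\<close>. The step is spent
        on reflexivity, which keeps the chain at the prescribed length.\<close>
      then show ?thesis using less.prems(1) sim_refl by (intro exI[of _ f]) (auto simp: ker_def)
    qed
    then obtain g u where g: "lin g" "sim f g" "u \<in> carrier V"
      "(g ^^ Suc (Suc k)) u = \<zero>\<^bsub>V\<^esub>" "(g ^^ Suc k) u \<noteq> \<zero>\<^bsub>V\<^esub>" by blast
    have k': "Suc (Suc k) \<le> dm" using index_le[of g u "Suc (Suc k)"] g by simp
    then obtain h l x where h: "lin h" "chain (dm - Suc (Suc k)) g h" "single_block l x h"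
      using less.hyps[OF _ g(1,3,4,5)] by (meson diff_less_mono2 lessI less_le_trans)
    have "dm - Suc k = Suc (dm - Suc (Suc k))" using k' by simp
    then have "chain (dm - Suc k) f h" using g h by auto
    then show ?thesis using h by blast
  qed
qed

text \<open>The map is \<open>x \<mapsto> \<Sum>i<m. f\<^sup>i v \<phi>(g\<^sup>m\<^sup>-\<^sup>1\<^sup>-\<^sup>i x)\<close>, built by Horner's scheme.\<close>

lemma obtain_intertwiner:
  assumes f: "lin f" and g: "lin g" and \<phi>: "linf \<phi>" and v: "v \<in> carrier V"
  obtains t where "lin t"
    "\<And>x. x \<in> carrier V \<Longrightarrow> f (t x) \<oplus>\<^bsub>V\<^esub> \<phi> ((g ^^ Suc m) x) \<odot>\<^bsub>V\<^esub> v = t (g x) \<oplus>\<^bsub>V\<^esub> \<phi> x \<odot>\<^bsub>V\<^esub> (f ^^ Suc m) v"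
    "\<And>x. x \<in> carrier V \<Longrightarrow> (\<And>i. \<phi> ((g ^^ i) x) = \<zero>) \<Longrightarrow> t x = \<zero>\<^bsub>V\<^esub>"
    "\<And>x. x \<in> carrier V \<Longrightarrow> \<exists>y\<in>carrier V. t x = f y \<oplus>\<^bsub>V\<^esub> \<phi> ((g ^^ m) x) \<odot>\<^bsub>V\<^esub> v"
proof -
  define t where "t = rec_nat (\<lambda>x. \<zero>\<^bsub>V\<^esub>) (\<lambda>m s x. f (s x) \<oplus>\<^bsub>V\<^esub> \<phi> ((g ^^ m) x) \<odot>\<^bsub>V\<^esub> v)"
  have t0: "t 0 = (\<lambda>x. \<zero>\<^bsub>V\<^esub>)" and tS: "t (Suc m) = (\<lambda>x. f (t m x) \<oplus>\<^bsub>V\<^esub> \<phi> ((g ^^ m) x) \<odot>\<^bsub>V\<^esub> v)" for m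
    by (simp_all add: t_def)
  have lt: "lin (t m)" for m
  proof (induction m)
    case 0 then show ?case by (auto simp: t0 intro!: linI)
  next
    case (Suc m)
    show ?case unfolding tS
      by (rule lin_plus[OF lin_comp[OF f Suc] lin_rank_one[OF linf_comp[OF \<phi> lin_pow[OF g]] v]])
  qed
  \<comment> \<open>A telescoping sum: applying \<open>f\<close> and precomposing with
    \<open>g\<close> give the same terms up to a shift of the summation index, so only the two end
    terms remain.\<close>
  have "f (t m x) \<oplus>\<^bsub>V\<^esub> \<phi> ((g ^^ m) x) \<odot>\<^bsub>V\<^esub> v = t m (g x) \<oplus>\<^bsub>V\<^esub> \<phi> x \<odot>\<^bsub>V\<^esub> (f ^^ m) v" if x: "x \<in> carrier V" for m x
  proof (induction m)
    case 0
    then show ?case using f by (simp add: t0)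
  next
    case (Suc m)
    have "f (t (Suc m) x) = f (t m (g x) \<oplus>\<^bsub>V\<^esub> \<phi> x \<odot>\<^bsub>V\<^esub> (f ^^ m) v)"
      unfolding tS Suc ..
    also have "\<dots> = f (t m (g x)) \<oplus>\<^bsub>V\<^esub> \<phi> x \<odot>\<^bsub>V\<^esub> (f ^^ Suc m) v"
      using x f g \<phi> v lt[of m] by (simp add: lin_add lin_smult)
    finally show ?case
      using x f g \<phi> v lt[of m] by (simp add: tS funpow_swap1 V.a_ac)
  qed
  moreover have "t m x = \<zero>\<^bsub>V\<^esub>" if "x \<in> carrier V" "\<And>i. \<phi> ((g ^^ i) x) = \<zero>" for m x
    by (induction m) (use that f v in \<open>auto simp: t0 tS\<close>)
  moreover have "\<exists>y\<in>carrier V. t (Suc m) x = f y \<oplus>\<^bsub>V\<^esub> \<phi> ((g ^^ m) x) \<odot>\<^bsub>V\<^esub> v" if "x \<in> carrier V" for x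
    using that lt[of m] by (auto simp: tS)
  ultimately show ?thesis using that[of "t (Suc m)"] lt by blast
qed

text \<open>The conjugating map is \<open>p\<close> after \<open>g ^^ m\<close> plus a Horner map
  \<open>t0\<close>. The former kills the nilpotent part of \<open>g\<close> and carries the
  invertible part; \<open>t0\<close> kills the image of \<open>g ^^ m\<close> and sends the block of
  \<open>g\<close> to that of \<open>f\<close>. Surjectivity is shown, and injectivity follows. That
  \<open>k\<close> and \<open>l\<close> agree never has to be proved.\<close>

lemma single_block_conj_le:
  assumes f: "lin f" "single_block k v f" and g: "lin g" "single_block l u g" and "k \<le> l"
    and fg: "shift_equiv f g"
  shows "conjugate_maps f g"
proof -
  obtain p q r where pq0: "lin p" "lin q" "\<forall>x\<in>carrier V. f (p x) = p (g x)"
    "\<forall>x\<in>carrier V. q (f x) = g (q x)" "\<forall>x\<in>carrier V. p (q x) = (f ^^ r) x"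
    "\<forall>x\<in>carrier V. q (p x) = (g ^^ r) x"
    using fg unfolding shift_equiv_def by blast
  note pq = pq0(1,2) pq0(3-)[rule_format]
  have v: "v \<in> carrier V" "(f ^^ Suc k) v = \<zero>\<^bsub>V\<^esub>" "carrier V \<subseteq> adjoin (f ` carrier V) v"
    using f(2) unfolding single_block_def by auto
  have u: "u \<in> carrier V" "(g ^^ Suc l) u = \<zero>\<^bsub>V\<^esub>" "(g ^^ l) u \<noteq> \<zero>\<^bsub>V\<^esub>"
    "ker (g ^^ Suc (Suc l)) \<subseteq> ker (g ^^ Suc l)"
    using g(2) unfolding single_block_def by auto
  define m where "m = Suc l"
  have add: "(h ^^ i) ((h ^^ j) x) = (h ^^ (i + j)) x" for h :: "'v \<Rightarrow> 'v" and i j x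
    by (simp add: funpow_add)
  have "v \<in> ker (f ^^ m)"
    using ker_pow_mono[OF f(1), of "Suc k" m] v \<open>k \<le> l\<close> unfolding m_def by (auto simp: ker_def)
  then have fv: "(f ^^ m) v = \<zero>\<^bsub>V\<^esub>" by (simp add: ker_def)
  have S: "subsp ((g ^^ m) ` carrier V)"
    by (intro subsp_image lin_pow g subsp_carrier)
  have "(g ^^ l) u \<notin> (g ^^ m) ` carrier V"
  proof
    assume "(g ^^ l) u \<in> (g ^^ m) ` carrier V"
    then obtain y where y: "y \<in> carrier V" "(g ^^ l) u = (g ^^ m) y" by blast
    have "(g ^^ Suc m) y = \<zero>\<^bsub>V\<^esub>" using u(2) y by simp
    then have "(g ^^ m) y = \<zero>\<^bsub>V\<^esub>" using u(4) y unfolding m_def by (auto simp: ker_def)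
    then show False using u y by simp
  qed
  then obtain \<phi> where \<phi>0: "linf \<phi>" "\<And>x. x \<in> (g ^^ m) ` carrier V \<Longrightarrow> \<phi> x = \<zero>" "\<phi> ((g ^^ l) u) = \<one>"
    using obtain_functional[OF S pow_closed[OF g(1) u(1)]] by blast
  have \<phi>: "linf \<phi>" "\<And>x. x \<in> carrier V \<Longrightarrow> \<phi> ((g ^^ m) x) = \<zero>" "\<phi> ((g ^^ l) u) = \<one>"
    using \<phi>0 by auto
  \<comment> \<open>Both end terms vanish: \<open>\<phi>\<close> is zero on the image of
    \<open>g ^^ m\<close>, and \<open>f ^^ m\<close> kills \<open>v\<close> because
    \<open>k \<le> l\<close>. Hence \<open>t0\<close> intertwines \<open>f\<close> and
    \<open>g\<close>.\<close>
  obtain t0 where t0: "lin t0"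
    "\<And>x. x \<in> carrier V \<Longrightarrow> f (t0 x) \<oplus>\<^bsub>V\<^esub> \<phi> ((g ^^ m) x) \<odot>\<^bsub>V\<^esub> v = t0 (g x) \<oplus>\<^bsub>V\<^esub> \<phi> x \<odot>\<^bsub>V\<^esub> (f ^^ m) v"
    "\<And>x. x \<in> carrier V \<Longrightarrow> (\<And>i. \<phi> ((g ^^ i) x) = \<zero>) \<Longrightarrow> t0 x = \<zero>\<^bsub>V\<^esub>"
    "\<And>x. x \<in> carrier V \<Longrightarrow> \<exists>y\<in>carrier V. t0 x = f y \<oplus>\<^bsub>V\<^esub> \<phi> ((g ^^ l) x) \<odot>\<^bsub>V\<^esub> v"
    using obtain_intertwiner[OF f(1) g(1) \<phi>(1) v(1), of l] unfolding m_def by blast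
  have t0g: "f (t0 x) = t0 (g x)" if "x \<in> carrier V" for x
    using t0(2)[OF that] that \<phi>(1,2) fv v t0(1) f g by simp
  have t0m: "t0 ((g ^^ m) x) = \<zero>\<^bsub>V\<^esub>" if "x \<in> carrier V" for x
  proof (rule t0(3))
    show "\<phi> ((g ^^ i) ((g ^^ m) x)) = \<zero>" for i
      using \<phi>(2)[of "(g ^^ i) x"] that g by (simp add: add add.commute)
  qed (use that g in auto)
  define t where "t x = p ((g ^^ m) x) \<oplus>\<^bsub>V\<^esub> t0 x" for x
  have lt: "lin t" unfolding t_def by (rule lin_plus[OF lin_comp[OF pq(1) lin_pow[OF g(1)]] t0(1)])
  have tg: "f (t x) = t (g x)" if "x \<in> carrier V" for x
    using that pq(1,3) t0g t0(1) f g by (simp add: t_def lin_add funpow_swap1)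
  have tpow: "(f ^^ j) (t x) = t ((g ^^ j) x)" if "x \<in> carrier V" for j x
    by (rule intertwine_pow) (use lt f g tg that in auto)
  obtain y0 where y0: "y0 \<in> carrier V" "t u = f y0 \<oplus>\<^bsub>V\<^esub> v"
  proof -
    obtain y where y: "y \<in> carrier V" "t0 u = f y \<oplus>\<^bsub>V\<^esub> v"
      using t0(4)[OF u(1)] \<phi>(3) v by auto
    moreover have "t u = t0 u" using u pq(1) t0(1) unfolding t_def m_def by simp
    ultimately show ?thesis using that by simp
  qed
  \<comment> \<open>\<open>t u\<close> agrees with \<open>v\<close> modulo the image of
    \<open>f\<close>, so the images of \<open>f\<close> and \<open>t\<close> together span.
    Substituting this into itself raises the power of \<open>f\<close>.\<close>
  have step: "\<exists>y\<in>carrier V. \<exists>z\<in>carrier V. x = f y \<oplus>\<^bsub>V\<^esub> t z" if x: "x \<in> carrier V" for x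
  proof -
    obtain y a where ya: "y \<in> carrier V" "a \<in> carrier D" "x = f y \<oplus>\<^bsub>V\<^esub> a \<odot>\<^bsub>V\<^esub> v"
      using v(3) x by (blast elim: adjoinE)
    have "v = t u \<ominus>\<^bsub>V\<^esub> f y0"
      using y0 v f u lt by (subst V_eq_minus_iff) (auto simp: V.a_comm)
    also have "\<dots> = t u \<oplus>\<^bsub>V\<^esub> f ((\<ominus> \<one>) \<odot>\<^bsub>V\<^esub> y0)"
      using y0(1) f by (simp add: V_minus_eq lin_neg smult_minus_one)
    finally have "x = f y \<oplus>\<^bsub>V\<^esub> a \<odot>\<^bsub>V\<^esub> (t u \<oplus>\<^bsub>V\<^esub> f ((\<ominus> \<one>) \<odot>\<^bsub>V\<^esub> y0))"
      using ya(3) by simp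
    also have "\<dots> = f (y \<oplus>\<^bsub>V\<^esub> a \<odot>\<^bsub>V\<^esub> ((\<ominus> \<one>) \<odot>\<^bsub>V\<^esub> y0)) \<oplus>\<^bsub>V\<^esub> t (a \<odot>\<^bsub>V\<^esub> u)"
      using ya(1,2) y0(1) f(1) u(1) lt by (simp add: lin_add lin_smult smult_r_distr V.a_ac)
    finally show ?thesis using ya(1,2) y0(1) u(1) by blast
  qed
  have steps: "\<exists>y\<in>carrier V. \<exists>z\<in>carrier V. x = (f ^^ j) y \<oplus>\<^bsub>V\<^esub> t z" if x: "x \<in> carrier V" for x j
  proof (induction j)
    case 0
    show ?case using x lt by (intro bexI[of _ x] bexI[of _ "\<zero>\<^bsub>V\<^esub>"]) auto
  next
    case (Suc j)
    then obtain y z where yz: "y \<in> carrier V" "z \<in> carrier V" "x = (f ^^ j) y \<oplus>\<^bsub>V\<^esub> t z" by blast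
    obtain y' z' where yz': "y' \<in> carrier V" "z' \<in> carrier V" "y = f y' \<oplus>\<^bsub>V\<^esub> t z'"
      using step[OF yz(1)] by blast
    have "(f ^^ j) y = (f ^^ Suc j) y' \<oplus>\<^bsub>V\<^esub> t ((g ^^ j) z')"
      using lin_add[of "f ^^ j" "f y'" "t z'"] yz' f lt tpow by (simp add: funpow_swap1)
    then have "x = (f ^^ Suc j) y' \<oplus>\<^bsub>V\<^esub> t ((g ^^ j) z' \<oplus>\<^bsub>V\<^esub> z)"
      using yz(2,3) yz'(1,2) f g lt lin_add[OF lt, of "(g ^^ j) z'" z]
      by (simp add: V.a_assoc del: funpow.simps)
    then show ?case using yz(2) yz'(1,2) g by (metis V.a_closed pow_closed)
  qed
  have "carrier V \<subseteq> t ` carrier V"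
  proof
    fix x assume "x \<in> carrier V"
    \<comment> \<open>In the exponent, \<open>r\<close> turns into \<open>p\<close> after
      \<open>q\<close>. Of the two copies of \<open>m\<close>, one supplies the power of
      \<open>g\<close> in the definition of \<open>t\<close>, the other puts the argument into the
      image of \<open>g ^^ m\<close>, where \<open>t0\<close> vanishes.\<close>
    then obtain y z where yz: "y \<in> carrier V" "z \<in> carrier V" "x = (f ^^ (m + m + r)) y \<oplus>\<^bsub>V\<^esub> t z"
      using steps by blast
    have "(f ^^ (m + m + r)) y = (f ^^ (m + m)) (p (q y))" using pq(5)[OF yz(1)] by (simp add: add)
    also have "\<dots> = p ((g ^^ (m + m)) (q y))"
      by (rule intertwine_pow) (use pq f g yz in auto)
    also have "\<dots> = t ((g ^^ m) (q y))"
      using t0m[of "q y"] yz(1) pq(1,2) g by (simp add: t_def add)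
    finally have "x = t ((g ^^ m) (q y) \<oplus>\<^bsub>V\<^esub> z)"
      using yz pq(2) g lt by (simp add: lin_add)
    then show "x \<in> t ` carrier V" by (rule image_eqI) (use yz pq(2) g in auto)
  qed
  then have "ker t \<subseteq> {\<zero>\<^bsub>V\<^esub>}" by (rule surj_imp_inj[OF lt])
  then show ?thesis using conjugate_mapsI[OF lt] tg by blast
qed

lemma shift_equiv_sym: "shift_equiv f g \<Longrightarrow> shift_equiv g f"
  unfolding shift_equiv_def by metis

lemma single_block_conj:
  assumes "lin f" "single_block k v f" "lin g" "single_block l u g" "shift_equiv f g"
  shows "conjugate_maps f g"
proof (cases "k \<le> l")
  case True
  then show ?thesis using single_block_conj_le assms by blast
next
  case False
  then have "conjugate_maps g f" using single_block_conj_le[OF assms(3,4,1,2)] shift_equiv_sym assms by auto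
  then show ?thesis using conj_sym assms by blast
qed

section \<open>The invertible case and the bound on chains\<close>

lemma inj_conj:
  assumes f: "lin f" "ker f \<subseteq> {\<zero>\<^bsub>V\<^esub>}" and g: "lin g" and fg: "shift_equiv f g"
  shows "conjugate_maps f g"
proof -
  obtain p q k where pq0: "lin p" "lin q" "\<forall>x\<in>carrier V. f (p x) = p (g x)"
    "\<forall>x\<in>carrier V. q (f x) = g (q x)"
    "\<forall>x\<in>carrier V. p (q x) = (f ^^ k) x"
    "\<forall>x\<in>carrier V. q (p x) = (g ^^ k) x"
    using fg unfolding shift_equiv_def by blast
  note pq = pq0(1,2) pq0(3-)[rule_format]
  have f0: "y = \<zero>\<^bsub>V\<^esub>" if "y \<in> carrier V" "f y = \<zero>\<^bsub>V\<^esub>" for y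
    using f(2) that by (auto simp: ker_def)
  \<comment> \<open>\<open>q\<close> is injective because \<open>p\<close> after \<open>q\<close> is
    a power of the injective map \<open>f\<close>.\<close>
  have "ker q \<subseteq> {\<zero>\<^bsub>V\<^esub>}"
  proof
    fix x assume "x \<in> ker q"
    then have x: "x \<in> carrier V" "(f ^^ k) x = \<zero>\<^bsub>V\<^esub>" using pq(5)[of x] pq(1) by (auto simp: ker_def)
    moreover have "(f ^^ j) x = \<zero>\<^bsub>V\<^esub> \<Longrightarrow> x = \<zero>\<^bsub>V\<^esub>" for j
    proof (induction j)
      case (Suc j)
      then show ?case using f0[of "(f ^^ j) x"] f(1) x(1) by simp
    qed simp
    ultimately show "x \<in> {\<zero>\<^bsub>V\<^esub>}" by blast
  qed
  then have "conjugate_maps g f" by (rule conjugate_mapsI[OF pq(2)]) (use pq in auto)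
  then show ?thesis by (rule conj_sym[OF _ g f(1)])
qed

text \<open>
  With indices \<open>Suc a\<close> and \<open>Suc b\<close>, one route passes through maps of index one and takes \<open>a + b\<close> steps,
  the other through maps with a single nilpotent block and takes at most \<open>2 dm - 2 - (a + b)\<close> steps.
\<close>

theorem chain_bound:
  assumes fg: "chain k f g" and f: "lin f" and g: "lin g" and n: "1 \<le> n" "dm \<le> Suc n"
  shows "chain n f g"
proof -
  have conjugate_maps: "chain n f g" if "conjugate_maps f g"
    by (rule chain_conj_chain[of 0 f f g 0 g]) (use that f g n in auto)
  have se: "shift_equiv f g" by (rule chain_shift_equiv[OF fg f g])
  define index where "index h = (LEAST k. ker (h ^^ Suc k) \<subseteq> ker (h ^^ k))" for h :: "'v \<Rightarrow> 'v"
  have index: "ker (h ^^ Suc (index h)) \<subseteq> ker (h ^^ index h)" if "lin h" for h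
    unfolding index_def by (rule LeastI_ex[OF ker_stable[OF that]])
  have less: "\<exists>v\<in>carrier V. (h ^^ Suc k) v = \<zero>\<^bsub>V\<^esub> \<and> (h ^^ k) v \<noteq> \<zero>\<^bsub>V\<^esub>" if "index h = Suc k" for h k
    using not_less_Least[of k "\<lambda>k. ker (h ^^ Suc k) \<subseteq> ker (h ^^ k)"] that
    unfolding index_def[symmetric] by (auto simp: ker_def)
  consider "index f = 0" | "index g = 0" | a b where "index f = Suc a" "index g = Suc b"
    by (meson not0_implies_Suc)
  then show ?thesis
  proof cases
    case 1
    then have "ker f \<subseteq> {\<zero>\<^bsub>V\<^esub>}" using index[OF f] by (auto simp: ker_def)
    then show ?thesis using inj_conj f g se conjugate_maps by blast
  next
    case 2
    then have "ker g \<subseteq> {\<zero>\<^bsub>V\<^esub>}" using index[OF g] by (auto simp: ker_def)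
    then show ?thesis using inj_conj[of g f] f g se conjugate_maps conj_sym shift_equiv_sym by blast
  next
    case (3 a b)
    obtain v where v: "v \<in> carrier V" "(f ^^ Suc a) v = \<zero>\<^bsub>V\<^esub>" "(f ^^ a) v \<noteq> \<zero>\<^bsub>V\<^esub>"
      using less[OF 3(1)] by blast
    obtain u where u: "u \<in> carrier V" "(g ^^ Suc b) u = \<zero>\<^bsub>V\<^esub>" "(g ^^ b) u \<noteq> \<zero>\<^bsub>V\<^esub>"
      using less[OF 3(2)] by blast
    have se2: "shift_equiv x y" if "chain i f x" "chain j g y" "lin x" "lin y" for x y i j
      using chain_shift_equiv[OF chain_trans[OF chain_sym[OF that(1)] chain_trans[OF fg that(2)]]] that f g
      by blast
    show ?thesis
    proof (cases "a + b \<le> n")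
      case True
      obtain x where x: "lin x" "chain a f x" "index_one x"
        using chain_index_one[OF f, of a] index[OF f] 3 by auto
      obtain y where y: "lin y" "chain b g y" "index_one y"
        using chain_index_one[OF g, of b] index[OF g] 3 by auto
      have "conjugate_maps x y" using index_one_conj x y se2 by blast
      then show ?thesis
        using chain_conj_chain[OF x(2) _ chain_sym[OF y(2)]] x y f g True n by blast
    next
      case False
      have ab: "Suc a \<le> dm" "Suc b \<le> dm"
        using index_le[of f v "Suc a"] index_le[of g u "Suc b"] f g v u by auto
      obtain x i w where x: "lin x" "chain (dm - Suc a) f x" "single_block i w x"
        using chain_single_block[OF f v] by blast
      obtain y j z where y: "lin y" "chain (dm - Suc b) g y" "single_block j z y"
        using chain_single_block[OF g u] by blast
      have "conjugate_maps x y" using single_block_conj x y se2 by blast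
      \<comment> \<open>The length is \<open>2 * dm - 2 - (a + b)\<close>, at most
        \<open>2 * n - (a + b)\<close>, which is below \<open>n\<close> since \<open>a + b\<close>
        exceeds \<open>n\<close>. The bounds \<open>ab\<close> make the natural subtractions
        exact.\<close>
      then show ?thesis
        using chain_conj_chain[OF x(2) _ chain_sym[OF y(2)], of n] x y f g False n ab by auto
    qed
  qed
qed

end

section \<open>Matrices as endomorphisms\<close>

text \<open>Coordinates from \<open>n\<close> on are fixed to zero, so that equal vectors are equal
  functions. Scalars multiply on the right, which makes the left action of matrices linear over a
  noncommutative \<open>D\<close>.\<close>

definition col_space :: "nat \<Rightarrow> ('a, 'k) ring_scheme \<Rightarrow> ('a, nat \<Rightarrow> 'a) module" where
  "col_space n D = \<lparr>
     carrier = {x. (\<forall>i<n. x i \<in> carrier D) \<and> (\<forall>i\<ge>n. x i = \<zero>\<^bsub>D\<^esub>)},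
     monoid.mult = (\<lambda>x y. x), one = (\<lambda>i. \<zero>\<^bsub>D\<^esub>), zero = (\<lambda>i. \<zero>\<^bsub>D\<^esub>),
     add = (\<lambda>x y i. x i \<oplus>\<^bsub>D\<^esub> y i), smult = (\<lambda>a x i. x i \<otimes>\<^bsub>D\<^esub> a) \<rparr>"

text \<open>The positions at which some vector of \<open>W\<close> has its last nonzero coordinate.\<close>

definition pivots :: "nat \<Rightarrow> ('a, 'k) ring_scheme \<Rightarrow> (nat \<Rightarrow> 'a) set \<Rightarrow> nat set" where
  "pivots n D W = {i. i < n \<and> (\<exists>x\<in>W. x i \<noteq> \<zero>\<^bsub>D\<^esub> \<and> (\<forall>j>i. x j = \<zero>\<^bsub>D\<^esub>))}"

lemma col_space_simps [simp]:
  "x \<in> carrier (col_space n D) \<longleftrightarrow> (\<forall>i<n. x i \<in> carrier D) \<and> (\<forall>i\<ge>n. x i = \<zero>\<^bsub>D\<^esub>)"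
  "\<zero>\<^bsub>col_space n D\<^esub> = (\<lambda>i. \<zero>\<^bsub>D\<^esub>)"
  "x \<oplus>\<^bsub>col_space n D\<^esub> y = (\<lambda>i. x i \<oplus>\<^bsub>D\<^esub> y i)"
  "a \<odot>\<^bsub>col_space n D\<^esub> x = (\<lambda>i. x i \<otimes>\<^bsub>D\<^esub> a)"
  by (simp_all add: col_space_def)

section \<open>The rank of a subspace by Gaussian elimination\<close>

context skew_field
begin

lemma col_space_coeff: "x \<in> carrier (col_space n R) \<Longrightarrow> x i \<in> carrier R"
  by (cases "i < n") auto

lemma abelian_group_col_space: "abelian_group (col_space n R)"
proof (rule abelian_groupI)
  fix x y z assume "x \<in> carrier (col_space n R)" "y \<in> carrier (col_space n R)" "z \<in> carrier (col_space n R)"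
  then have "x i \<in> carrier R" "y i \<in> carrier R" "z i \<in> carrier R" for i by (auto intro: col_space_coeff)
  then show "x \<oplus>\<^bsub>col_space n R\<^esub> y \<oplus>\<^bsub>col_space n R\<^esub> z = x \<oplus>\<^bsub>col_space n R\<^esub> (y \<oplus>\<^bsub>col_space n R\<^esub> z)"
    by (simp add: a_assoc)
next
  fix x y assume "x \<in> carrier (col_space n R)" "y \<in> carrier (col_space n R)"
  then have "x i \<in> carrier R" "y i \<in> carrier R" for i by (auto intro: col_space_coeff)
  then show "x \<oplus>\<^bsub>col_space n R\<^esub> y = y \<oplus>\<^bsub>col_space n R\<^esub> x" by (simp add: a_comm)
next
  fix x assume x: "x \<in> carrier (col_space n R)"
  then have c: "x i \<in> carrier R" for i by (auto intro: col_space_coeff)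
  then show "\<zero>\<^bsub>col_space n R\<^esub> \<oplus>\<^bsub>col_space n R\<^esub> x = x" by simp
  show "\<exists>y\<in>carrier (col_space n R). y \<oplus>\<^bsub>col_space n R\<^esub> x = \<zero>\<^bsub>col_space n R\<^esub>"
    using x c by (intro bexI[of _ "\<lambda>i. \<ominus> x i"]) (auto simp: l_neg)
qed auto

text \<open>If the pivots coincided, elimination would reduce every vector of \<open>W'\<close> to
  zero by subtracting multiples of vectors of \<open>W\<close>, and so place it in
  \<open>W\<close>.\<close>

lemma pivots_strict:
  assumes W: "W \<subset> W'" "W' \<subseteq> carrier (col_space n R)" "(\<lambda>i. \<zero>) \<in> W"
    and add: "\<And>x y. x \<in> W \<Longrightarrow> y \<in> W \<Longrightarrow> (\<lambda>i. x i \<oplus> y i) \<in> W"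
    and smult: "\<And>a x. a \<in> carrier R \<Longrightarrow> x \<in> W \<Longrightarrow> (\<lambda>i. x i \<otimes> a) \<in> W"
    and add': "\<And>x y. x \<in> W' \<Longrightarrow> y \<in> W' \<Longrightarrow> (\<lambda>i. x i \<oplus> y i) \<in> W'"
  shows "pivots n R W \<subset> pivots n R W'"
proof -
  have cr: "x i \<in> carrier R" if "x \<in> W'" for x i
    using that W(2) col_space_coeff by blast
  have "x \<in> W" if eq: "pivots n R W = pivots n R W'" and "x \<in> W'" "\<forall>j\<ge>k. x j = \<zero>" for k x
    using that(2,3)
  proof (induction k arbitrary: x)
    case 0
    then have "x = (\<lambda>i. \<zero>)" by auto
    then show ?case using W by simp
  next
    case (Suc k)
    show ?case
    proof (cases "x k = \<zero>")
      case True
      then have "\<forall>j\<ge>k. x j = \<zero>" using Suc.prems by (metis Suc_leI le_neq_implies_less)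
      then show ?thesis using Suc by blast
    next
      case False
      have "k < n"
      proof (rule ccontr)
        assume "\<not> k < n"
        moreover have "x \<in> carrier (col_space n R)" using Suc.prems W(2) by blast
        ultimately show False using False by simp
      qed
      then have "k \<in> pivots n R W" unfolding eq using False Suc.prems by (auto simp: pivots_def)
      then obtain w where w: "w \<in> W" "w k \<noteq> \<zero>" "\<forall>j>k. w j = \<zero>" by (auto simp: pivots_def)
      have wW': "w \<in> W'" using w W by blast
      have "w k \<in> Units R" using skew_field_Units w cr[OF wW'] by blast
      then have b: "inv (w k) \<in> carrier R" "w k \<otimes> inv (w k) = \<one>" by auto
      define a where "a = inv (w k) \<otimes> x k"
      have a: "a \<in> carrier R" "w k \<otimes> a = x k"
        using b cr[OF wW'] cr[OF Suc.prems(1)] by (auto simp: a_def m_assoc[symmetric])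
      \<comment> \<open>Subtracting a multiple of \<open>w\<close> clears the last nonzero
        coordinate of \<open>x\<close>. The result stays in \<open>W'\<close>, so the induction
        hypothesis applies, and adding the multiple back returns to \<open>x\<close>.\<close>
      define y where "y i = x i \<oplus> w i \<otimes> (\<ominus> a)" for i
      have "y \<in> W'" unfolding y_def
        using add'[OF Suc.prems(1)] smult[of "\<ominus> a" w] w a W(1) by auto
      moreover have "\<forall>j\<ge>k. y j = \<zero>"
      proof (intro allI impI)
        fix j assume "k \<le> j"
        then consider "j = k" | "j > k" by linarith
        then show "y j = \<zero>"
        proof cases
          case 1
          then show ?thesis using a cr[OF wW'] cr[OF Suc.prems(1)] by (simp add: y_def r_minus r_neg)
        next
          case 2
          then show ?thesis using a w Suc.prems by (simp add: y_def)
        qed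
      qed
      ultimately have "y \<in> W" by (rule Suc.IH)
      then have "(\<lambda>i. y i \<oplus> w i \<otimes> a) \<in> W" using add smult w a by blast
      moreover have "(\<lambda>i. y i \<oplus> w i \<otimes> a) = x"
        using a cr[OF wW'] cr[OF Suc.prems(1)] by (auto simp: y_def r_minus a_assoc l_neg)
      ultimately show ?thesis by simp
    qed
  qed
  moreover have "\<forall>j\<ge>n. x j = \<zero>" if "x \<in> W'" for x using that W(2) by auto
  ultimately have "pivots n R W \<noteq> pivots n R W'" using W(1) by (metis psubset_imp_ex_mem DiffD1 DiffD2)
  moreover have "pivots n R W \<subseteq> pivots n R W'" using W(1) by (auto simp: pivots_def)
  ultimately show ?thesis by blast
qed

lemma card_pivots_le: "card (pivots n R W) \<le> n"
proof -
  have "pivots n R W \<subseteq> {..<n}" by (auto simp: pivots_def)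
  from card_mono[OF _ this] show ?thesis by simp
qed

lemma right_space_col_space: "right_space R (col_space n R) (\<lambda>W. card (pivots n R W)) n"
proof (intro right_space.intro right_space_axioms.intro)
  show "skew_field R" by (rule skew_field_axioms)
  show "abelian_group (col_space n R)" by (rule abelian_group_col_space)
next
  fix W W' :: "(nat \<Rightarrow> 'a) set"
  assume *: "W \<subset> W'" "W' \<subseteq> carrier (col_space n R)" "\<zero>\<^bsub>col_space n R\<^esub> \<in> W"
    "\<And>x y. x \<in> W \<Longrightarrow> y \<in> W \<Longrightarrow> x \<oplus>\<^bsub>col_space n R\<^esub> y \<in> W"
    "\<And>a x. a \<in> carrier R \<Longrightarrow> x \<in> W \<Longrightarrow> a \<odot>\<^bsub>col_space n R\<^esub> x \<in> W"
    "\<And>x y. x \<in> W' \<Longrightarrow> y \<in> W' \<Longrightarrow> x \<oplus>\<^bsub>col_space n R\<^esub> y \<in> W'"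
  have "pivots n R W \<subset> pivots n R W'"
    using pivots_strict[OF *(1,2)] *(3-) by simp
  moreover have "finite (pivots n R W')" by (simp add: pivots_def)
  ultimately show "card (pivots n R W) < card (pivots n R W')" by (rule psubset_card_mono[rotated])
qed (auto simp: col_space_coeff card_pivots_le l_distr r_distr m_assoc)

end

section \<open>The correspondence between matrices and endomorphisms\<close>

locale matrix_space = skew_field D for D :: "('a, 'k) ring_scheme" (structure) + fixes n :: nat
begin

abbreviation "V \<equiv> col_space n D"
abbreviation "M \<equiv> matrix_ring n D"

sublocale right_space D V "\<lambda>W. card (pivots n D W)" n
  by (rule right_space_col_space)

definition unit_col :: "nat \<Rightarrow> nat \<Rightarrow> 'a" where
  "unit_col j i = (if i = j then \<one> else \<zero>)"

definition act :: "'a mat \<Rightarrow> (nat \<Rightarrow> 'a) \<Rightarrow> nat \<Rightarrow> 'a" where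
  "act A x i = (if i < n then \<Oplus>j\<in>{..<n}. A $$ (i, j) \<otimes> x j else \<zero>)"

definition mat_of :: "((nat \<Rightarrow> 'a) \<Rightarrow> nat \<Rightarrow> 'a) \<Rightarrow> 'a mat" where
  "mat_of f = mat n n (\<lambda>(i, j). f (unit_col j) i)"

lemma coeff_closed [simp]: "x \<in> carrier V \<Longrightarrow> x i \<in> carrier D"
  by (rule col_space_coeff)

lemma lin_coeff: "lin f \<Longrightarrow> x \<in> carrier V \<Longrightarrow> f x i \<in> carrier D"
  using coeff_closed lin_closed by blast

lemma unit_col_closed: "j < n \<Longrightarrow> unit_col j \<in> carrier V"
  by (auto simp: unit_col_def)

lemma mem_matrix_ring:
  "A \<in> carrier M \<longleftrightarrow> A \<in> carrier_mat n n \<and> (\<forall>i<n. \<forall>j<n. A $$ (i, j) \<in> carrier D)"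
  unfolding matrix_ring_def by (force dest!: elements_matD intro: elements_matI)

lemma mat_of_closed: "lin f \<Longrightarrow> mat_of f \<in> carrier M"
  unfolding mem_matrix_ring mat_of_def by (auto intro: lin_coeff unit_col_closed simp del: col_space_simps)

text \<open>Induction over the truncations of \<open>x\<close>: passing from \<open>tr k\<close> to
  \<open>tr (Suc k)\<close> adds the \<open>k\<close>-th unit column scaled by
  \<open>x k\<close>.\<close>

lemma lin_expand:
  assumes f: "lin f" and x: "x \<in> carrier V"
  shows "f x i = (\<Oplus>j\<in>{..<n}. f (unit_col j) i \<otimes> x j)"
proof -
  define tr where "tr k = (\<lambda>i. if i < k then x i else \<zero>)" for k
  have tr: "tr k \<in> carrier V" if "k \<le> n" for k
    using that x by (auto simp: tr_def)
  have "k \<le> n \<Longrightarrow> f (tr k) i = (\<Oplus>j\<in>{..<k}. f (unit_col j) i \<otimes> x j)" for k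
  proof (induction k)
    case 0
    have "tr 0 = \<zero>\<^bsub>V\<^esub>" by (simp add: tr_def)
    then show ?case using lin_zero[OF f] by (simp add: tr_def)
  next
    case (Suc k)
    have u: "unit_col k \<in> carrier V" using Suc.prems by (intro unit_col_closed) simp
    have "tr (Suc k) = x k \<odot>\<^bsub>V\<^esub> unit_col k \<oplus>\<^bsub>V\<^esub> tr k"
      using coeff_closed[OF x] by (auto simp: tr_def unit_col_def fun_eq_iff less_Suc_eq)
    then have "f (tr (Suc k)) = x k \<odot>\<^bsub>V\<^esub> f (unit_col k) \<oplus>\<^bsub>V\<^esub> f (tr k)"
      using f x u tr[of k] Suc.prems coeff_closed[OF x, of k]
      by (simp add: lin_add lin_smult del: col_space_simps)
    then have "f (tr (Suc k)) i = f (unit_col k) i \<otimes> x k \<oplus> f (tr k) i" by simp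
    also have "\<dots> = (\<Oplus>j\<in>{..<Suc k}. f (unit_col j) i \<otimes> x j)"
      unfolding lessThan_Suc using Suc lin_coeff[OF f unit_col_closed] coeff_closed[OF x]
      by (subst finsum_insert) (auto simp: Pi_def)
    finally show ?case .
  qed
  moreover have "tr n = x" using x by (auto simp: tr_def)
  ultimately show ?thesis by (metis order_refl)
qed

lemma act_mat_of:
  assumes "lin f" "x \<in> carrier V" shows "act (mat_of f) x = f x"
proof
  fix i
  show "act (mat_of f) x i = f x i"
  proof (cases "i < n")
    case True
    have "(\<Oplus>j\<in>{..<n}. mat_of f $$ (i, j) \<otimes> x j) = (\<Oplus>j\<in>{..<n}. f (unit_col j) i \<otimes> x j)"
      using True by (intro finsum_cong')
        (auto simp: mat_of_def intro!: m_closed lin_coeff[OF assms(1) unit_col_closed] coeff_closed[OF assms(2)]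
          simp del: col_space_simps)
    then show ?thesis using True lin_expand[OF assms, of i] by (simp add: act_def)
  next
    case False
    then show ?thesis using lin_closed[OF assms] by (simp add: act_def)
  qed
qed

lemma lin_act:
  assumes A: "A \<in> carrier M" shows "lin (act A)"
proof -
  have c: "A $$ (i, j) \<in> carrier D" if "i < n" "j < n" for i j using A that mem_matrix_ring by blast
  show ?thesis
  proof (rule linI)
    show "act A x \<in> carrier V" if "x \<in> carrier V" for x
      using coeff_closed[OF that] c by (auto simp: act_def intro!: finsum_closed)
    show "act A (x \<oplus>\<^bsub>V\<^esub> y) = act A x \<oplus>\<^bsub>V\<^esub> act A y" if "x \<in> carrier V" "y \<in> carrier V" for x y
    proof
      fix i
      show "act A (x \<oplus>\<^bsub>V\<^esub> y) i = (act A x \<oplus>\<^bsub>V\<^esub> act A y) i"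
      proof (cases "i < n")
        case True
        have "(\<Oplus>j\<in>{..<n}. A $$ (i, j) \<otimes> (x j \<oplus> y j)) = (\<Oplus>j\<in>{..<n}. A $$ (i, j) \<otimes> x j \<oplus> A $$ (i, j) \<otimes> y j)"
          using True c coeff_closed[OF that(1)] coeff_closed[OF that(2)] by (intro finsum_cong') (auto simp: r_distr)
        also have "\<dots> = (\<Oplus>j\<in>{..<n}. A $$ (i, j) \<otimes> x j) \<oplus> (\<Oplus>j\<in>{..<n}. A $$ (i, j) \<otimes> y j)"
          using True c coeff_closed[OF that(1)] coeff_closed[OF that(2)] by (intro finsum_addf) auto
        finally show ?thesis using True by (simp add: act_def)
      qed (simp add: act_def)
    qed
    show "act A (a \<odot>\<^bsub>V\<^esub> x) = a \<odot>\<^bsub>V\<^esub> act A x" if "a \<in> carrier D" "x \<in> carrier V" for a x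
    proof
      fix i
      show "act A (a \<odot>\<^bsub>V\<^esub> x) i = (a \<odot>\<^bsub>V\<^esub> act A x) i"
      proof (cases "i < n")
        case True
        have "(\<Oplus>j\<in>{..<n}. A $$ (i, j) \<otimes> (x j \<otimes> a)) = (\<Oplus>j\<in>{..<n}. (A $$ (i, j) \<otimes> x j) \<otimes> a)"
          using True c that(1) coeff_closed[OF that(2)] by (intro finsum_cong') (auto simp: m_assoc)
        also have "\<dots> = (\<Oplus>j\<in>{..<n}. A $$ (i, j) \<otimes> x j) \<otimes> a"
          using True c that(1) coeff_closed[OF that(2)] by (intro finsum_ldistr[symmetric]) auto
        finally show ?thesis using True by (simp add: act_def)
      qed (use that in \<open>simp add: act_def\<close>)
    qed
  qed
qed

lemma mat_of_act:
  assumes A: "A \<in> carrier M" shows "mat_of (act A) = A"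
proof (rule eq_matI)
  have c: "A $$ (i, j) \<in> carrier D" if "i < n" "j < n" for i j using A that mem_matrix_ring by blast
  show "dim_row (mat_of (act A)) = dim_row A" "dim_col (mat_of (act A)) = dim_col A"
    using A by (auto simp: mat_of_def mem_matrix_ring)
  fix i j assume "i < dim_row A" "j < dim_col A"
  then have ij: "i < n" "j < n" using A by (auto simp: mem_matrix_ring)
  have "(\<Oplus>k\<in>{..<n}. A $$ (i, k) \<otimes> unit_col j k) = (\<Oplus>k\<in>{..<n}. if j = k then A $$ (i, k) else \<zero>)"
    using ij c by (intro finsum_cong') (auto simp: unit_col_def)
  also have "\<dots> = A $$ (i, j)"
    using ij c by (intro finsum_singleton) auto
  finally show "mat_of (act A) $$ (i, j) = A $$ (i, j)"
    using ij by (simp add: mat_of_def act_def)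
qed

lemma mat_of_comp:
  assumes f: "lin f" and g: "lin g"
  shows "mat_of (\<lambda>x. f (g x)) = mat_of f \<otimes>\<^bsub>M\<^esub> mat_of g"
proof (rule eq_matI)
  show "dim_row (mat_of (\<lambda>x. f (g x))) = dim_row (mat_of f \<otimes>\<^bsub>M\<^esub> mat_of g)"
    "dim_col (mat_of (\<lambda>x. f (g x))) = dim_col (mat_of f \<otimes>\<^bsub>M\<^esub> mat_of g)"
    by (simp_all add: mat_of_def matrix_ring_def)
  fix i j assume "i < dim_row (mat_of f \<otimes>\<^bsub>M\<^esub> mat_of g)" "j < dim_col (mat_of f \<otimes>\<^bsub>M\<^esub> mat_of g)"
  then have ij: "i < n" "j < n" by (simp_all add: mat_of_def matrix_ring_def)
  have u: "g (unit_col j) \<in> carrier V" using g ij unit_col_closed lin_closed by blast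
  have "f (g (unit_col j)) i = (\<Oplus>k\<in>{..<n}. f (unit_col k) i \<otimes> g (unit_col j) k)"
    by (rule lin_expand[OF f u])
  also have "\<dots> = (\<Oplus>k\<in>{..<n}. mat_of f $$ (i, k) \<otimes> mat_of g $$ (k, j))"
    using ij by (intro finsum_cong')
      (auto simp: mat_of_def intro!: m_closed lin_coeff[OF f unit_col_closed] lin_coeff[OF g unit_col_closed]
        simp del: col_space_simps)
  finally show "mat_of (\<lambda>x. f (g x)) $$ (i, j) = (mat_of f \<otimes>\<^bsub>M\<^esub> mat_of g) $$ (i, j)"
    using ij by (simp add: mat_of_def matrix_ring_def)
qed

lemma mat_of_cong: "(\<And>x. x \<in> carrier V \<Longrightarrow> f x = g x) \<Longrightarrow> mat_of f = mat_of g"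
  unfolding mat_of_def using unit_col_closed by (intro eq_matI) (simp_all del: col_space_simps)

lemma act_mult:
  assumes "A \<in> carrier M" "B \<in> carrier M" "x \<in> carrier V"
  shows "act (A \<otimes>\<^bsub>M\<^esub> B) x = act A (act B x)"
proof -
  have "A \<otimes>\<^bsub>M\<^esub> B = mat_of (\<lambda>x. act A (act B x))"
    using mat_of_comp[OF lin_act lin_act] mat_of_act assms by simp
  then show ?thesis using act_mat_of lin_comp[OF lin_act lin_act] assms by simp
qed

lemma simn_imp_chain: "simn M k A B \<Longrightarrow> A \<in> carrier M \<Longrightarrow> chain k (act A) (act B)"
proof (induction k arbitrary: A)
  case (Suc k)
  then obtain C where C: "C \<in> carrier M" "sim1 M A C" "simn M k C B" by auto
  then obtain c d where cd: "c \<in> carrier M" "d \<in> carrier M" "A = c \<otimes>\<^bsub>M\<^esub> d" "C = d \<otimes>\<^bsub>M\<^esub> c"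
    unfolding sim1_def by blast
  have "sim (act A) (act C)"
    by (rule simI[of "act c" "act d"]) (use cd lin_act act_mult in \<open>simp_all del: col_space_simps\<close>)
  then show ?case using C lin_act Suc.IH by auto
qed simp

lemma chain_imp_simn: "chain k f g \<Longrightarrow> simn M k (mat_of f) (mat_of g)"
proof (induction k arbitrary: f)
  case 0
  then show ?case using mat_of_cong[of f g] by (simp del: col_space_simps)
next
  case (Suc k)
  then obtain h where h: "lin h" "sim f h" "chain k h g" by auto
  then obtain c d where cd: "lin c" "lin d" "\<And>x. x \<in> carrier V \<Longrightarrow> f x = c (d x)"
    "\<And>x. x \<in> carrier V \<Longrightarrow> h x = d (c x)" unfolding sim_def by blast
  have "mat_of f = mat_of c \<otimes>\<^bsub>M\<^esub> mat_of d" "mat_of h = mat_of d \<otimes>\<^bsub>M\<^esub> mat_of c"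
    using mat_of_cong[OF cd(3)] mat_of_cong[OF cd(4)] mat_of_comp cd(1,2) by simp_all
  then have "sim1 M (mat_of f) (mat_of h)"
    unfolding sim1_def using mat_of_closed cd(1,2) by blast
  then show ?case using Suc.IH[OF h(3)] mat_of_closed[OF h(1)] by auto
qed

lemma simn_bound:
  assumes "simn M k A B" "A \<in> carrier M" "B \<in> carrier M" "1 \<le> m" "n \<le> Suc m"
  shows "simn M m A B"
proof -
  have "chain m (act A) (act B)"
    using chain_bound[OF simn_imp_chain] lin_act assms by blast
  then show ?thesis using chain_imp_simn mat_of_act assms by metis
qed

lemma simn_refl: assumes "A \<in> carrier M" shows "simn M k A A"
proof -
  have "chain k (act A) (act A)" by (rule chain_mono[of 0]) (use lin_act assms in auto)
  then show ?thesis using chain_imp_simn mat_of_act assms by metis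
qed

section \<open>The lower bound\<close>

lemma chain_zero_nilpotent:
  "chain m f (\<lambda>x. \<zero>\<^bsub>V\<^esub>) \<Longrightarrow> lin f \<Longrightarrow> x \<in> carrier V \<Longrightarrow> (f ^^ Suc m) x = \<zero>\<^bsub>V\<^esub>"
proof (induction m arbitrary: f x)
  case (Suc m)
  then obtain h where h: "lin h" "sim f h" "chain m h (\<lambda>x. \<zero>\<^bsub>V\<^esub>)" by auto
  then obtain c d where cd: "lin c" "lin d" "\<And>x. x \<in> carrier V \<Longrightarrow> f x = c (d x)"
    "\<And>x. x \<in> carrier V \<Longrightarrow> h x = d (c x)" unfolding sim_def by blast
  \<comment> \<open>\<open>c\<close> intertwines \<open>f\<close> with \<open>h\<close>, so one
    further power of \<open>f\<close> suffices to pass the nilpotency of \<open>h\<close> on to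
    \<open>f\<close>.\<close>
  have "(f ^^ Suc m) (c (d x)) = c ((h ^^ Suc m) (d x))"
    by (rule intertwine_pow) (use cd h Suc.prems in \<open>auto simp del: col_space_simps\<close>)
  also have "\<dots> = \<zero>\<^bsub>V\<^esub>"
    using Suc.IH[OF h(3,1), of "d x"] cd(1,2) Suc.prems(3) by (simp del: col_space_simps funpow.simps)
  finally show ?case using cd(3) Suc.prems(3) by (simp add: funpow_swap1 del: col_space_simps)
qed simp

text \<open>The witnesses are the shift of coordinates, a full nilpotent block, and zero. The chain
  of length \<open>n\<close> only shows that they are connected and need not be shortest.\<close>

lemma far_from_zero:
  assumes n: "1 \<le> n"
  shows "\<exists>A\<in>carrier M. \<exists>Z\<in>carrier M. simn M n A Z \<and> (\<forall>m. simn M m A Z \<longrightarrow> n - 1 \<le> m)"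
proof -
  define shift :: "(nat \<Rightarrow> 'a) \<Rightarrow> nat \<Rightarrow> 'a" where "shift x i = x (Suc i)" for x i
  define tr :: "nat \<Rightarrow> (nat \<Rightarrow> 'a) \<Rightarrow> nat \<Rightarrow> 'a" where "tr k x i = (if i < k then x i else \<zero>)" for k x i
  have lz: "lin (\<lambda>x. \<zero>\<^bsub>V\<^esub>)" by (rule linI) auto
  have ls: "lin shift"
  proof (rule linI)
    show "shift x \<in> carrier V" if "x \<in> carrier V" for x
      using coeff_closed[OF that] that by (auto simp: shift_def)
  qed (auto simp: shift_def)
  have lt: "lin (tr k)" for k
    by (rule linI) (auto simp: tr_def fun_eq_iff)
  have "chain k (\<lambda>x. shift (tr k x)) (\<lambda>x. \<zero>\<^bsub>V\<^esub>)" for k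
  proof (induction k)
    case 0
    then show ?case by (auto simp: shift_def tr_def)
  next
    case (Suc k)
    \<comment> \<open>After the shift, a vector truncated at \<open>Suc k\<close> already has
      support below \<open>k\<close>, so \<open>tr k\<close> fixes it. In the other order
      \<open>tr k\<close> comes first and cuts the block down.\<close>
    have "sim (\<lambda>x. shift (tr (Suc k) x)) (\<lambda>x. shift (tr k x))"
      by (rule simI[OF lt[of k] lin_comp[OF ls lt[of "Suc k"]]]) (auto simp: shift_def tr_def fun_eq_iff)
    then show ?case using Suc lin_comp[OF ls lt[of k]] by auto
  qed
  from this[of n] have ch: "chain n shift (\<lambda>x. \<zero>\<^bsub>V\<^esub>)"
    by (rule chain_cong_left) (auto simp: shift_def tr_def fun_eq_iff)
  have "n - 1 \<le> m" if s: "simn M m (mat_of shift) (mat_of (\<lambda>x. \<zero>\<^bsub>V\<^esub>))" for m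
  proof (rule ccontr)
    assume m: "\<not> n - 1 \<le> m"
    have e: "act (mat_of shift) x = shift x" "act (mat_of (\<lambda>x. \<zero>\<^bsub>V\<^esub>)) x = \<zero>\<^bsub>V\<^esub>" if "x \<in> carrier V" for x
      using act_mat_of[OF ls that] act_mat_of[OF lz that] by blast+
    have 1: "chain m (act (mat_of shift)) (act (mat_of (\<lambda>x. \<zero>\<^bsub>V\<^esub>)))"
      using simn_imp_chain[OF s mat_of_closed[OF ls]] .
    have 2: "chain 0 shift (act (mat_of shift))"
      unfolding chain.simps by (rule ballI, rule e(1)[symmetric])
    have 3: "chain 0 (act (mat_of (\<lambda>x. \<zero>\<^bsub>V\<^esub>))) (\<lambda>x. \<zero>\<^bsub>V\<^esub>)"
      unfolding chain.simps by (rule ballI, rule e(2))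
    have "chain m shift (\<lambda>x. \<zero>\<^bsub>V\<^esub>)"
      using chain_trans[OF 2 chain_trans[OF 1 3]] by simp
    then have "(shift ^^ Suc m) (unit_col (n - 1)) = \<zero>\<^bsub>V\<^esub>"
      using chain_zero_nilpotent[OF _ ls] unit_col_closed[of "n - 1"] n by simp
    moreover have "(shift ^^ j) x i = x (i + j)" for j x i
      by (induction j arbitrary: i) (auto simp: shift_def)
    \<comment> \<open>Coordinate \<open>n - 2 - m\<close> of the shifted vector is the original
      coordinate \<open>n - 1\<close>; the subtraction is genuine because \<open>m\<close> is below
      \<open>n - 1\<close>.\<close>
    ultimately have "unit_col (n - 1) (n - 2 - m + Suc m) = \<zero>"
      by (metis col_space_simps(2))
    moreover have "n - 2 - m + Suc m = n - 1" using m by simp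
    ultimately have "unit_col (n - 1) (n - 1) = \<zero>" by metis
    then show False using zero_not_one by (simp add: unit_col_def)
  qed
  then show ?thesis using chain_imp_simn[OF ch] mat_of_closed ls lz by blast
qed

end

section \<open>Products and the diameter\<close>

lemma sim1_hom:
  assumes "h \<in> carrier R \<rightarrow> carrier S"
    and "\<And>x y. x \<in> carrier R \<Longrightarrow> y \<in> carrier R \<Longrightarrow> h (x \<otimes>\<^bsub>R\<^esub> y) = h x \<otimes>\<^bsub>S\<^esub> h y"
    and "sim1 R a b"
  shows "sim1 S (h a) (h b)"
proof -
  obtain c d where cd: "c \<in> carrier R" "d \<in> carrier R" "a = c \<otimes>\<^bsub>R\<^esub> d" "b = d \<otimes>\<^bsub>R\<^esub> c"
    using assms(3) unfolding sim1_def by blast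
  then have "h a = h c \<otimes>\<^bsub>S\<^esub> h d" "h b = h d \<otimes>\<^bsub>S\<^esub> h c" using assms(2) by auto
  then show ?thesis unfolding sim1_def using cd assms(1) by blast
qed

lemma simn_hom:
  assumes h: "h \<in> carrier R \<rightarrow> carrier S"
    and mult: "\<And>x y. x \<in> carrier R \<Longrightarrow> y \<in> carrier R \<Longrightarrow> h (x \<otimes>\<^bsub>R\<^esub> y) = h x \<otimes>\<^bsub>S\<^esub> h y"
    and "simn R k a b"
  shows "simn S k (h a) (h b)"
  using assms(3)
proof (induction k arbitrary: a)
  case (Suc k)
  then obtain c where c: "c \<in> carrier R" "sim1 R a c" "simn R k c b" by auto
  have "sim1 S (h a) (h c)" using sim1_hom[OF h mult c(2)] by blast
  then show ?case using Suc.IH[OF c(3)] c(1) h by auto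
qed simp

lemma simn_trans: "simn R i a b \<Longrightarrow> simn R j b c \<Longrightarrow> simn R (i + j) a c"
  by (induction i arbitrary: a) auto

lemma simn_sym: "simn R k a b \<Longrightarrow> a \<in> carrier R \<Longrightarrow> simn R k b a"
proof (induction k arbitrary: a)
  case (Suc k)
  then obtain c where c: "c \<in> carrier R" "sim1 R a c" "simn R k c b" by auto
  have "sim1 R c a" using c(2) unfolding sim1_def by blast
  then have "simn R (Suc 0) c a" using Suc.prems by simp
  then show ?case using simn_trans[OF Suc.IH[OF c(3,1)], of "Suc 0" a] by simp
qed simp

text \<open>Two elements of one closure are connected through its base point, so
  \<open>upper\<close> bounds their distance. Since \<open>comm_dist\<close> is a
  \<open>LEAST\<close>, the pair \<open>a\<close>, \<open>b\<close> must be known to be connected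
  before \<open>lower\<close> bounds its distance; the length \<open>k\<close> may be
  arbitrary.\<close>

lemma ring_diam_eqI:
  assumes upper: "\<And>x y k. \<lbrakk>x \<in> carrier R; y \<in> carrier R; simn R k x y\<rbrakk> \<Longrightarrow> simn R m x y"
    and a: "a \<in> carrier R" and b: "b \<in> carrier R" and ab: "simn R k a b"
    and lower: "\<And>j. simn R j a b \<Longrightarrow> m \<le> j"
  shows "ring_diam R = enat m"
proof (rule antisym)
  have "enat (comm_dist R x y) \<le> enat m"
    if xy: "x \<in> comm_closure R c" "y \<in> comm_closure R c" for c x y
  proof -
    obtain i j where ij: "x \<in> carrier R" "y \<in> carrier R" "simn R i x c" "simn R j y c"
      using xy unfolding comm_closure_def by blast
    have "simn R (j + i) y x" by (rule simn_trans[OF ij(4) simn_sym[OF ij(3,1)]])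
    then have "simn R m y x" using upper ij by blast
    then show ?thesis unfolding comm_dist_def by (simp add: Least_le)
  qed
  then show "ring_diam R \<le> enat m"
    unfolding ring_diam_def closure_diam_def by (auto intro!: SUP_least)
  have "simn R (comm_dist R b a) a b" unfolding comm_dist_def by (rule LeastI) (rule ab)
  then have "enat m \<le> enat (comm_dist R b a)" using lower by simp
  also have "\<dots> \<le> closure_diam R b"
  proof -
    have "a \<in> comm_closure R b" "b \<in> comm_closure R b"
      unfolding comm_closure_def using a b ab by (auto intro: exI[of _ 0])
    then show ?thesis unfolding closure_diam_def by (auto intro!: SUP_upper2[of "(b, a)"])
  qed
  also have "\<dots> \<le> ring_diam R" unfolding ring_diam_def using b by (auto intro: SUP_upper)
  finally show "enat m \<le> ring_diam R" .
qed

section \<open>Componentwise chains in finite products\<close>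

lemma RDirProd_list_Cons_carrier:
  "a # as \<in> carrier (RDirProd_list (R # Rs)) \<longleftrightarrow> a \<in> carrier R \<and> as \<in> carrier (RDirProd_list Rs)"
  by (auto simp: RDirProd_list_carrier)

lemma RDirProd_list_Cons_mult:
  assumes "a \<in> carrier R" "b \<in> carrier R" "as \<in> carrier (RDirProd_list Rs)" "bs \<in> carrier (RDirProd_list Rs)"
  shows "(a # as) \<otimes>\<^bsub>RDirProd_list (R # Rs)\<^esub> (b # bs) = (a \<otimes>\<^bsub>R\<^esub> b) # (as \<otimes>\<^bsub>RDirProd_list Rs\<^esub> bs)"
  using ring_hom_mult[OF RDirProd_list_hom1, of "(a, as)" R Rs "(b, bs)"] assms
  by (simp add: RDirProd_carrier) (simp add: RDirProd_def DirProd_def monoid.defs)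

lemma RDirProd_list_mult_nth:
  assumes "as \<in> carrier (RDirProd_list Rs)" "bs \<in> carrier (RDirProd_list Rs)" "i < length Rs"
  shows "(as \<otimes>\<^bsub>RDirProd_list Rs\<^esub> bs) ! i = as ! i \<otimes>\<^bsub>Rs ! i\<^esub> bs ! i"
  using assms
proof (induction Rs arbitrary: as bs i)
  case (Cons R Rs)
  obtain a as' b bs' where *: "as = a # as'" "bs = b # bs'"
    using Cons.prems(1,2) by (auto simp: RDirProd_list_carrier)
  with Cons.prems have c: "a \<in> carrier R" "b \<in> carrier R" "as' \<in> carrier (RDirProd_list Rs)" "bs' \<in> carrier (RDirProd_list Rs)"
    by (simp_all add: RDirProd_list_Cons_carrier)
  show ?case
    unfolding * RDirProd_list_Cons_mult[OF c] using Cons.IH[OF c(3,4)] Cons.prems(3) by (cases i) auto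
qed simp

lemma simn_RDirProd_list_nth:
  assumes "simn (RDirProd_list Rs) k as bs" "i < length Rs"
  shows "simn (Rs ! i) k (as ! i) (bs ! i)"
  by (rule simn_hom[OF _ _ assms(1)]) (use assms(2) in \<open>auto simp: RDirProd_list_carrier_mem RDirProd_list_mult_nth\<close>)

text \<open>One step in the product performs a step in every component at once, so the component
  chains must have a common length.\<close>

lemma simn_RDirProd_list_Cons:
  assumes "simn R k a b" "simn (RDirProd_list Rs) k as bs"
  shows "simn (RDirProd_list (R # Rs)) k (a # as) (b # bs)"
  using assms
proof (induction k arbitrary: a as)
  case (Suc k)
  obtain c where c: "c \<in> carrier R" "sim1 R a c" "simn R k c b" using Suc.prems by auto
  obtain cs where cs: "cs \<in> carrier (RDirProd_list Rs)" "sim1 (RDirProd_list Rs) as cs" "simn (RDirProd_list Rs) k cs bs"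
    using Suc.prems by auto
  obtain p q where p: "p \<in> carrier R" "q \<in> carrier R" "a = p \<otimes>\<^bsub>R\<^esub> q" "c = q \<otimes>\<^bsub>R\<^esub> p"
    using c(2) unfolding sim1_def by blast
  obtain ps qs where ps: "ps \<in> carrier (RDirProd_list Rs)" "qs \<in> carrier (RDirProd_list Rs)"
    "as = ps \<otimes>\<^bsub>RDirProd_list Rs\<^esub> qs" "cs = qs \<otimes>\<^bsub>RDirProd_list Rs\<^esub> ps"
    using cs(2) unfolding sim1_def by blast
  have "sim1 (RDirProd_list (R # Rs)) (a # as) (c # cs)"
    unfolding sim1_def using p ps
    by (intro bexI[of _ "p # ps"] bexI[of _ "q # qs"]) (auto simp: RDirProd_list_Cons_mult RDirProd_list_Cons_carrier)
  moreover have "c # cs \<in> carrier (RDirProd_list (R # Rs))"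
    using c cs by (simp add: RDirProd_list_Cons_carrier)
  ultimately show ?case using Suc.IH[OF c(3) cs(3)] by auto
qed simp

lemma simn_RDirProd_list:
  assumes "as \<in> carrier (RDirProd_list Rs)" "bs \<in> carrier (RDirProd_list Rs)"
    "\<And>i. i < length Rs \<Longrightarrow> simn (Rs ! i) k (as ! i) (bs ! i)"
  shows "simn (RDirProd_list Rs) k as bs"
  using assms
proof (induction Rs arbitrary: as bs)
  case Nil
  have "sim1 (RDirProd_list []) [] []" unfolding sim1_def by (auto simp: monoid.defs)
  then have "simn (RDirProd_list []) k [] []" by (induction k) auto
  then show ?case using Nil by simp
next
  case (Cons R Rs)
  obtain a as' b bs' where *: "as = a # as'" "bs = b # bs'"
    using Cons.prems(1,2) by (auto simp: RDirProd_list_carrier)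
  have c: "as' \<in> carrier (RDirProd_list Rs)" "bs' \<in> carrier (RDirProd_list Rs)"
    using Cons.prems(1,2) * by (simp_all add: RDirProd_list_Cons_carrier)
  have "simn (Rs ! i) k (as' ! i) (bs' ! i)" if "i < length Rs" for i
    using Cons.prems(3)[of "Suc i"] that * by simp
  then have "simn (RDirProd_list Rs) k as' bs'" using Cons.IH c by blast
  then show ?case using simn_RDirProd_list_Cons Cons.prems(3)[of 0] * by auto
qed

text \<open>One by one matrices over a field commute, so a step changes nothing. This covers the
  case of diameter zero.\<close>

lemma sim1_matrix_ring_one:
  assumes "field D" "sim1 (matrix_ring 1 D) A B" shows "A = B"
proof -
  interpret field D by fact
  obtain c d where cd: "c \<in> carrier (matrix_ring 1 D)" "d \<in> carrier (matrix_ring 1 D)"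
    "A = c \<otimes>\<^bsub>matrix_ring 1 D\<^esub> d" "B = d \<otimes>\<^bsub>matrix_ring 1 D\<^esub> c"
    using assms(2) unfolding sim1_def by blast
  have "c $$ (0, 0) \<in> carrier D" "d $$ (0, 0) \<in> carrier D"
    using cd(1,2) by (auto simp: matrix_ring_def)
  then show ?thesis unfolding cd(3,4) by (auto simp: matrix_ring_def m_comm lessThan_Suc intro!: eq_matI)
qed

lemma simn_matrix_ring_one: "field D \<Longrightarrow> simn (matrix_ring 1 D) k A B \<Longrightarrow> A = B"
  by (induction k arbitrary: A) (auto dest: sim1_matrix_ring_one)

theorem theorem3p10:
  fixes R :: "('r, 'm) ring_scheme"
    and l :: nat
    and n :: "nat \<Rightarrow> nat"
    and D :: "nat \<Rightarrow> ('a, 'k) ring_scheme"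
  assumes "semisimple_ring R"
    and "1 \<le> l"
    and "\<And>i. i \<in> {1..l} \<Longrightarrow> 1 \<le> n i"
    and "\<And>i. i \<in> {1..l} \<Longrightarrow> skew_field (D i)"
    and "R \<simeq> RDirProd_list (map (\<lambda>i. matrix_ring (n i) (D i)) [1..<Suc l])"
    and nonexceptional: "(\<exists>i\<in>{1..l}. 2 \<le> n i) \<or> (\<forall>i\<in>{1..l}. field (D i))"
  shows "ring_diam R = enat (Max {n i - 1 |i. i \<in> {1..l}})"
proof -
  let ?Rs = "map (\<lambda>i. matrix_ring (n i) (D i)) [1..<Suc l]"
  define P where "P = RDirProd_list ?Rs"
  define m where "m = Max {n i - 1 |i. i \<in> {1..l}}"
  \<comment> \<open>List positions count from 0, the factors from 1.\<close>
  have nth: "?Rs ! i = matrix_ring (n (Suc i)) (D (Suc i))" if "i < l" for i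
    using that by (simp del: upt_Suc)
  have ms: "matrix_space (D i)" if "i \<in> {1..l}" for i
    using assms(4)[OF that] by (rule matrix_space.intro)
  have eq: "{n i - 1 |i. i \<in> {1..l}} = (\<lambda>i. n i - 1) ` {1..l}" by auto
  have le: "n i \<le> Suc m" if "i \<in> {1..l}" for i
  proof -
    have "n i - 1 \<le> m" unfolding m_def eq using that by (intro Max_ge) auto
    then show ?thesis by simp
  qed
  have "m \<in> (\<lambda>i. n i - 1) ` {1..l}" unfolding m_def eq using assms(2) by (intro Max_in) auto
  then obtain i0 where i0: "i0 \<in> {1..l}" "m = n i0 - 1" by blast
  \<comment> \<open>If \<open>m = 0\<close>, all blocks have size one and
    \<open>nonexceptional\<close> makes every \<open>D i\<close> a field. Otherwise \<open>m\<close>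
    is at least 1, as the bound on chains requires; it also covers the smaller blocks, among them
    those of size one over a noncommutative division ring.\<close>
  have comp: "simn (matrix_ring (n i) (D i)) m A B"
    if i: "i \<in> {1..l}" and AB: "A \<in> carrier (matrix_ring (n i) (D i))" "B \<in> carrier (matrix_ring (n i) (D i))"
      "simn (matrix_ring (n i) (D i)) k A B" for i k A B
  proof (cases "m = 0")
    case True
    then have "n j = 1" if "j \<in> {1..l}" for j using le[OF that] assms(3)[OF that] by simp
    then have "field (D i)" "n i = 1" using nonexceptional i by fastforce+
    then show ?thesis using simn_matrix_ring_one AB True by auto
  next
    case False
    then show ?thesis using matrix_space.simn_bound[OF ms[OF i] AB(3,1,2), of m] le[OF i] by simp
  qed
  have upper: "simn P m as bs" if "as \<in> carrier P" "bs \<in> carrier P" "simn P k as bs" for as bs k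
    unfolding P_def
  proof (rule simn_RDirProd_list)
    fix i assume i: "i < length ?Rs"
    then have l: "i < l" by (simp del: upt_Suc)
    have "as ! i \<in> carrier (?Rs ! i)" "bs ! i \<in> carrier (?Rs ! i)"
      using RDirProd_list_carrier_mem(2) that(1,2) i unfolding P_def by blast+
    then show "simn (?Rs ! i) m (as ! i) (bs ! i)"
      using simn_RDirProd_list_nth[OF that(3)[unfolded P_def] i] comp[of "Suc i"] l
      unfolding nth[OF l] by simp
  qed (use that in \<open>simp_all add: P_def\<close>)
  have far: "\<exists>A Z. A \<in> carrier (matrix_ring (n i) (D i)) \<and> Z \<in> carrier (matrix_ring (n i) (D i))
     \<and> simn (matrix_ring (n i) (D i)) (n i) A Z
     \<and> (\<forall>j. simn (matrix_ring (n i) (D i)) j A Z \<longrightarrow> n i - 1 \<le> j)" if "i \<in> {1..l}" for i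
    using matrix_space.far_from_zero[OF ms[OF that] assms(3)[OF that]] by blast
  then obtain A Z where AZ: "\<And>i. i \<in> {1..l} \<Longrightarrow> A i \<in> carrier (matrix_ring (n i) (D i))"
    "\<And>i. i \<in> {1..l} \<Longrightarrow> Z i \<in> carrier (matrix_ring (n i) (D i))"
    "\<And>i. i \<in> {1..l} \<Longrightarrow> simn (matrix_ring (n i) (D i)) (n i) (A i) (Z i)"
    "\<And>i j. i \<in> {1..l} \<Longrightarrow> simn (matrix_ring (n i) (D i)) j (A i) (Z i) \<Longrightarrow> n i - 1 \<le> j"
    by metis
  \<comment> \<open>The two elements differ only in a component of largest size; in the others the
    chain stays constant at \<open>Z i\<close>.\<close>
  define as where "as = map (\<lambda>i. if i = i0 then A i else Z i) [1..<Suc l]"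
  define bs where "bs = map Z [1..<Suc l]"
  have as_nth: "as ! i = (if Suc i = i0 then A (Suc i) else Z (Suc i))" if "i < l" for i
    using that by (simp add: as_def del: upt_Suc)
  have bs_nth: "bs ! i = Z (Suc i)" if "i < l" for i
    using that by (simp add: bs_def del: upt_Suc)
  have as: "as \<in> carrier P" unfolding P_def
  proof (rule RDirProd_list_carrier_memI)
    fix i assume "i < length ?Rs"
    then show "as ! i \<in> carrier (?Rs ! i)" using AZ(1,2)[of "Suc i"] as_nth[of i] nth[of i] by (auto simp del: upt_Suc)
  qed (simp add: as_def)
  have bs: "bs \<in> carrier P" unfolding P_def
  proof (rule RDirProd_list_carrier_memI)
    fix i assume "i < length ?Rs"
    then show "bs ! i \<in> carrier (?Rs ! i)" using AZ(2)[of "Suc i"] bs_nth[of i] nth[of i] by (simp del: upt_Suc)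
  qed (simp add: bs_def)
  have ab: "simn P (n i0) as bs" unfolding P_def
  proof (rule simn_RDirProd_list)
    fix i assume "i < length ?Rs"
    then have l: "i < l" "Suc i \<in> {1..l}" by (auto simp del: upt_Suc)
    show "simn (?Rs ! i) (n i0) (as ! i) (bs ! i)"
      unfolding nth[OF l(1)] as_nth[OF l(1)] bs_nth[OF l(1)]
      using AZ(3)[OF l(2)] matrix_space.simn_refl[OF ms[OF l(2)] AZ(2)[OF l(2)]] by auto
  qed (use as bs in \<open>simp_all add: P_def\<close>)
  have lower: "m \<le> j" if "simn P j as bs" for j
  proof -
    have i: "i0 - 1 < l" "Suc (i0 - 1) = i0" using i0(1) by auto
    have "simn (?Rs ! (i0 - 1)) j (as ! (i0 - 1)) (bs ! (i0 - 1))"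
      using simn_RDirProd_list_nth[OF that[unfolded P_def], of "i0 - 1"] i by (simp del: upt_Suc)
    then have "simn (matrix_ring (n i0) (D i0)) j (A i0) (Z i0)"
      unfolding nth[OF i(1)] as_nth[OF i(1)] bs_nth[OF i(1)] i(2) by simp
    then show ?thesis using AZ(4)[OF i0(1)] i0(2) by simp
  qed
  have "ring R" using assms(1) unfolding semisimple_ring_def by blast
  obtain h where h: "h \<in> ring_iso R P" using assms(5) unfolding is_ring_iso_def P_def by blast
  define g where "g = inv_into (carrier R) h"
  have g: "g \<in> ring_iso P R" unfolding g_def by (rule ring_iso_set_sym[OF \<open>ring R\<close> h])
  \<comment> \<open>Chains involve nothing but multiplication in the carrier, so the isomorphism and
    its inverse carry them over without changing their lengths.\<close>
  have hs: "simn P k (h x) (h y)" if "simn R k x y" for k x y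
    using ring_iso_memE(1,2)[OF h] by (intro simn_hom[OF _ _ that]) auto
  have gs: "simn R k (g x) (g y)" if "simn P k x y" for k x y
    using ring_iso_memE(1,2)[OF g] by (intro simn_hom[OF _ _ that]) auto
  have bij: "bij_betw h (carrier R) (carrier P)" using h by (simp add: ring_iso_def)
  have hc: "h x \<in> carrier P" and gh: "g (h x) = x" if "x \<in> carrier R" for x
    using that bij unfolding g_def by (auto simp: bij_betw_def inv_into_f_f)
  have gc: "g x \<in> carrier R" and hg: "h (g x) = x" if "x \<in> carrier P" for x
    using that bij unfolding g_def by (auto simp: bij_betw_def inv_into_into f_inv_into_f)
  have "ring_diam R = enat m"
  proof (rule ring_diam_eqI)
    show "simn R m x y" if "x \<in> carrier R" "y \<in> carrier R" "simn R k x y" for x y k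
      using gs[OF upper[OF hc hc hs]] that gh by metis
    show "g as \<in> carrier R" "g bs \<in> carrier R" using gc as bs by auto
    show "simn R (n i0) (g as) (g bs)" using gs[OF ab] .
    show "m \<le> j" if "simn R j (g as) (g bs)" for j
      using hs[OF that] lower hg as bs by simp
  qed
  then show ?thesis by (simp add: m_def)
qed

end
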